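(* Let $m>0$ be a real number and, for $\delta>0$, let $f_\delta(z)=e^{-\delta|z|^m}$, $z\in\mathbb C$. Then the following are equivalent: (1) $B_{\alpha,m}B_{\beta,m}f=B_{\beta,m}B_{\alpha,m}f$ for all $f\in L^\infty(\mathbb C)$ and all $\alpha,\beta>0$; (2) $B_{\alpha,m}B_{\beta,m}f_\delta=B_{\beta,m}B_{\alpha,m}f_\delta$ for all $\alpha,\beta,\delta>0$; (3) $(B_{\alpha,m}B_{\beta,m}f_\delta)(0)=(B_{\beta,m}B_{\alpha,m}f_\delta)(0)$ for all $\alpha,\beta,\delta>0$; (4) $m=2$.
   Context: For real $m>0$ and $\alpha>0$, let $d\mu_{\alpha,m}(z)=\frac{m\alpha^{2/m}}{2\pi\Gamma(2/m)}e^{-\alpha|z|^m}\,dA(z)$, where $dA$ is Lebesgue area measure on $\mathbb C$ (so $\mu_{\alpha,m}(\mathbb C)=1$). Let $F^2_{\alpha,m}$ be the Hilbert space of entire functions that are square integrable with respect to $\mu_{\alpha,m}$, and let $K_{\alpha,m}(\cdot,\cdot)$ be its reproducing kernel, i.e. $f(z)=\langle f,K_{\alpha,m}(\cdot,z)\rangle_{L^2(\mu_{\alpha,m})}$ for $f\in F^2_{\alpha,m}$. The Berezin transform of $f\in L^\infty(\mathbb C)$ is $(B_{\alpha,m}f)(z)=\int_{\mathbb C} f(w)\frac{|K_{\alpha,m}(w,z)|^2}{K_{\alpha,m}(z,z)}\,d\mu_{\alpha,m}(w)$, $z\in\mathbb C$; it maps $L^\infty(\mathbb C)$ into itself. *)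

theory Defs
  imports "HOL-Analysis.Analysis"
begin

text \<open>The probability measure mu_{alpha,m} on the complex plane (Lebesgue area measure
  with the normalized density).\<close>
definition fock_measure :: "real \<Rightarrow> real \<Rightarrow> complex measure" where
  "fock_measure \<alpha> m = density lebesgue
     (\<lambda>z. ennreal (m * \<alpha> powr (2 / m) / (2 * pi * Gamma (2 / m)) * exp (- \<alpha> * cmod z powr m)))"

definition fock_space :: "real \<Rightarrow> real \<Rightarrow> (complex \<Rightarrow> complex) set" where
  "fock_space \<alpha> m = {f. f holomorphic_on UNIV \<and>
     integrable (fock_measure \<alpha> m) (\<lambda>z. (cmod (f z))\<^sup>2)}"

definition fock_inner :: "real \<Rightarrow> real \<Rightarrow> (complex \<Rightarrow> complex) \<Rightarrow> (complex \<Rightarrow> complex) \<Rightarrow> complex" where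
  "fock_inner \<alpha> m f g = (LINT w|fock_measure \<alpha> m. f w * cnj (g w))"

definition fock_kernel :: "real \<Rightarrow> real \<Rightarrow> complex \<Rightarrow> complex \<Rightarrow> complex" where
  "fock_kernel \<alpha> m = (THE K. (\<forall>z. (\<lambda>w. K w z) \<in> fock_space \<alpha> m) \<and>
     (\<forall>f\<in>fock_space \<alpha> m. \<forall>z. f z = fock_inner \<alpha> m f (\<lambda>w. K w z)))"

definition berezin :: "real \<Rightarrow> real \<Rightarrow> (complex \<Rightarrow> complex) \<Rightarrow> complex \<Rightarrow> complex" where
  "berezin \<alpha> m f z = (LINT w|fock_measure \<alpha> m.
     f w * complex_of_real ((cmod (fock_kernel \<alpha> m w z))\<^sup>2) / fock_kernel \<alpha> m z z)"

definition Linfty :: "(complex \<Rightarrow> complex) set" where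
  "Linfty = {f. f \<in> borel_measurable lebesgue \<and> (\<exists>C. AE z in lebesgue. cmod (f z) \<le> C)}"

end

theory Submission
  imports Defs "HOL-Complex_Analysis.Cauchy_Integral_Formula" "HOL-Real_Asymp.Real_Asymp"
begin

text \<open>
  Put \<open>s = 2/m\<close>. Monomials are orthogonal, so the kernel is \<open>K(w, z) = q(\<alpha>\<^sup>s w cnj z)\<close> for an entire
  function \<open>q\<close> with positive coefficients that depends only on \<open>m\<close> and has \<open>q 0 = 1\<close>. Since
  \<open>exp (- \<delta> |w|\<^sup>m) d\<mu>\<^sub>\<beta>\<close> is a multiple of \<open>d\<mu>\<close> for the parameter \<open>\<beta> + \<delta>\<close>, the reproducing property gives
  \<open>B\<^sub>\<beta> f\<^sub>\<delta>\<close> as a quotient of two values of \<open>q\<close>. Commutation at \<open>0\<close> for the parameters \<open>\<alpha>\<close> and \<open>1\<close>, divided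
  by \<open>\<alpha>\<^sup>s\<close> and taken to the limit \<open>\<alpha> \<rightarrow> 0\<close>, becomes
  \<open>\<integral> q(c\<^sup>s |w|\<^sup>2) / q(|w|\<^sup>2) dA(w) = const \<cdot> (1 - c) powr (- s)\<close> for \<open>0 < c < 1\<close>. As \<open>c \<rightarrow> 0\<close> the left side is
  \<open>a + \<Theta>(c\<^sup>s)\<close>, because it is a power series in \<open>c\<^sup>s\<close> with positive coefficients, while the right side
  is \<open>const \<cdot> (1 + s c + o(c))\<close>; hence \<open>s = 1\<close>. Conversely, for \<open>m = 2\<close> the Berezin transforms are
  convolutions with Gaussians.
\<close>

section \<open>Rotations and radial integrals in the complex plane\<close>

text \<open>Orthogonal invariance of Lebesgue measure is stated for \<open>real^2\<close>; this
  identification carries it to the complex plane. It holds because boxes pull back to boxes with the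
  same side lengths.\<close>

lemma lborel_complex_vec:
  "lborel = distr (lborel :: (real^2) measure) borel (\<lambda>v. Complex (v $ 1) (v $ 2))"
proof (rule lborel_eqI)
  fix l u :: complex
  assume le: "\<And>b. b \<in> Basis \<Longrightarrow> l \<bullet> b \<le> u \<bullet> b"
  define T where "T = (\<lambda>v::real^2. Complex (v $ 1) (v $ 2))"
  have T: "T \<in> borel_measurable borel"
    unfolding T_def Complex_eq
    by (intro borel_measurable_continuous_onI continuous_intros)
  have "T -` box l u = box (\<chi> i. if i = 1 then Re l else Im l) (\<chi> i. if i = 1 then Re u else Im u)"
    by (auto simp: T_def mem_box_cart in_box_complex_iff forall_2)
  moreover have "emeasure lborel \<dots> = (\<Prod>b\<in>Basis. (u - l) \<bullet> b)"
    using le[of 1] le[of \<i>]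
    by (subst emeasure_lborel_box)
       (auto simp: Basis_complex_def Basis_vec_def inner_axis' UN_Un prod.UNION_disjoint
          forall_2 UNIV_2 axis_eq_axis inner_axis)
  ultimately show "emeasure (distr lborel borel (\<lambda>v::real^2. Complex (v $ 1) (v $ 2))) (box l u) =
      (\<Prod>b\<in>Basis. (u - l) \<bullet> b)"
    unfolding T_def[symmetric] using T by (subst emeasure_distr) auto
qed simp

text \<open>Multiplication by a unimodular number is an orthogonal map of \<open>real^2\<close> in
  the coordinates \<open>T\<close> and \<open>S\<close>, and such maps preserve Lebesgue
  measure.\<close>

lemma distr_lborel_complex_rotation:
  fixes u :: complex
  assumes u: "cmod u = 1"
  shows "distr lborel borel ((*) u) = lborel"
proof -
  define T where "T = (\<lambda>v::real^2. Complex (v $ 1) (v $ 2))"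
  define S where "S = (\<lambda>z. vector [Re z, Im z] :: real^2)"
  have TS: "T (S z) = z" for z by (simp add: T_def S_def)
  have ST: "S (T v) = v" for v by (simp add: T_def S_def vec_eq_iff forall_2)
  have T: "T \<in> borel_measurable borel"
    unfolding T_def Complex_eq
    by (intro borel_measurable_continuous_onI continuous_intros)
  have linT: "linear T"
    by (rule linearI) (simp_all add: T_def complex_eq_iff)
  have linS: "linear S"
    by (rule linearI) (simp_all add: S_def vec_eq_iff forall_2)
  have normT: "norm (T v) = norm v" for v
    by (simp add: T_def norm_vec_def L2_set_def cmod_def UNIV_2)
  have normS: "norm (S z) = norm z" for z
    using normT[of "S z"] by (simp add: TS)
  \<comment> \<open>The conjugate inverts \<open>u\<close>, so the preimage of a box under
    multiplication by \<open>u\<close> becomes an image under \<open>R\<close>, to which the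
    invariance theorem for orthogonal images applies.\<close>
  define R where "R = (\<lambda>v. S (cnj u * T v))"
  have orth: "orthogonal_transformation R"
    unfolding orthogonal_transformation
  proof
    show "linear R" unfolding R_def
      using linear_compose[OF linear_compose[OF linT] linS, of "\<lambda>z. cnj u * z"]
      by (simp add: o_def bounded_linear.linear bounded_linear_mult_right)
    show "\<forall>v. norm (R v) = norm v"
      by (simp add: R_def normS normT norm_mult u)
  qed
  have uu: "u * cnj u = 1" using u complex_norm_square[of u] by simp
  have "lborel = distr lborel borel ((*) u)"
  proof (rule lborel_eqI)
    fix l r :: complex
    assume le: "\<And>b. b \<in> Basis \<Longrightarrow> l \<bullet> b \<le> r \<bullet> b"
    define A where "A = T -` box l r"
    have A: "A \<in> sets borel" unfolding A_def using measurable_sets_borel[OF T] by simp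
    have emA: "emeasure lborel A = emeasure lborel (box l r)"
      unfolding A_def using T by (subst lborel_complex_vec) (simp add: emeasure_distr T_def)
    have lmA: "A \<in> lmeasurable"
      using A emA emeasure_lborel_box_finite[of l r] by (intro fmeasurableI) (auto simp: top.not_eq_extremum)
    have img: "T -` ((*) u -` box l r) = R ` A"
    proof (intro set_eqI iffI)
      fix v assume "v \<in> T -` ((*) u -` box l r)"
      then have "S (u * T v) \<in> A" by (simp add: A_def TS)
      moreover have "R (S (u * T v)) = v"
        using uu by (simp add: R_def TS ST mult.assoc[symmetric] mult.commute[of "cnj u" u])
      ultimately show "v \<in> R ` A" by force
    next
      fix v assume "v \<in> R ` A"
      then show "v \<in> T -` ((*) u -` box l r)"
        using uu by (auto simp: A_def R_def TS mult.assoc[symmetric])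
    qed
    have mu: "(*) u \<in> borel_measurable borel" by measurable
    have B: "(*) u -` box l r \<in> sets borel" using measurable_sets_borel[OF mu] by simp
    have C: "R ` A \<in> sets borel"
      unfolding img[symmetric] using measurable_sets_borel[OF T B] by simp
    have "emeasure (distr lborel borel ((*) u)) (box l r) = emeasure lborel ((*) u -` box l r)"
      using mu by (simp add: emeasure_distr)
    also have "\<dots> = emeasure lborel (R ` A)"
      unfolding img[symmetric] using T B
      by (subst lborel_complex_vec) (simp add: emeasure_distr T_def)
    also have "\<dots> = emeasure lebesgue (R ` A)"
      using C by simp
    also have "\<dots> = emeasure lebesgue A"
      using measurable_orthogonal_image[OF orth lmA] measure_orthogonal_image[OF orth lmA] lmA
      by (simp add: emeasure_eq_measure2 fmeasurableD2)
    also have "\<dots> = emeasure lborel (box l r)"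
      using A emA by simp
    also have "\<dots> = (\<Prod>b\<in>Basis. (r - l) \<bullet> b)"
      using le by simp
    finally show "emeasure (distr lborel borel ((*) u)) (box l r) = (\<Prod>b\<in>Basis. (r - l) \<bullet> b)" .
  qed simp
  then show ?thesis by simp
qed

text \<open>For \<open>a \<ge> 0\<close> the sublevel set \<open>cmod z powr m \<le> a\<close> is a
  disc of area \<open>pi * a powr (2/m)\<close>, and the density is the derivative of this area in
  \<open>a\<close>. The half-lines form an intersection-stable generator, so comparing both measures
  on them is enough.\<close>

lemma distr_lborel_cmod_powr:
  fixes m :: real
  assumes m: "m > 0"
  shows "distr lborel borel (\<lambda>z::complex. cmod z powr m) =
    density lborel (\<lambda>t. ennreal (indicator {0..} t * (pi * (2/m) * t powr (2/m - 1))))"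
    (is "?D = density lborel ?d")
proof (rule measure_eqI_generator_eq)
  let ?E = "range (\<lambda>a::real. {..a})"
  have meas: "(\<lambda>z::complex. cmod z powr m) \<in> borel_measurable borel" by measurable
  have fin: "emeasure ?D {..a} = (if a < 0 then 0 else ennreal (pi * a powr (2/m)))" for a
  proof (cases "a < 0")
    case True
    then have "(\<lambda>z::complex. cmod z powr m) -` {..a} = {}"
      by (auto simp: not_le) (meson less_le_not_le order_trans powr_ge_zero)
    with True show ?thesis using meas by (simp add: emeasure_distr)
  next
    case False
    have "(\<lambda>z::complex. cmod z powr m) -` {..a} = cball 0 (a powr (1/m))"
    proof (intro set_eqI, simp)
      fix z :: complex
      have "cmod z powr m \<le> a \<longleftrightarrow> (cmod z powr m) powr (1/m) \<le> a powr (1/m)"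
        using m False by (cases "cmod z powr m \<le> a")
          (auto simp: not_le intro: powr_mono2 powr_less_mono2)
      then show "cmod z powr m \<le> a \<longleftrightarrow> cmod z \<le> a powr (1/m)"
        using m by (simp add: powr_powr)
    qed
    then have "emeasure ?D {..a} = ennreal (pi * (a powr (1/m))^2)"
      using meas by (simp add: emeasure_distr emeasure_cball unit_ball_vol_2)
    also have "(a powr (1/m))^2 = a powr (2/m)"
      by (simp add: power2_eq_square powr_add[symmetric])
    finally show ?thesis using False by simp
  qed
  show "Int_stable ?E" by (auto simp: Int_stable_def)
  show "?E \<subseteq> Pow UNIV" "sets ?D = sigma_sets UNIV ?E" "sets (density lborel ?d) = sigma_sets UNIV ?E"
    by (simp_all add: borel_eq_atMost)
  show "range (\<lambda>i::nat. {..real i}) \<subseteq> ?E" by auto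
  show "(\<Union>i::nat. {..real i}) = UNIV" by (auto simp: real_arch_simple)
  show "emeasure ?D {..real i} \<noteq> \<infinity>" for i by (simp add: fin)
  fix X assume "X \<in> ?E"
  then obtain a where X: "X = {..a}" by auto
  show "emeasure ?D X = emeasure (density lborel ?d) X"
  proof (cases "a < 0")
    case True
    then have *: "?d t * indicator {..a} t = 0" for t
      by (auto simp: indicator_def)
    then have "emeasure (density lborel ?d) X = 0"
      by (subst emeasure_density) (auto simp: X * simp del: mult_eq_0_iff)
    then show ?thesis using True fin[of a] X by simp
  next
    case False
    have "((\<lambda>t. pi * (2/m) * t powr (2/m - 1)) has_integral
        (pi * (2/m) * (a powr (2/m - 1 + 1) / (2/m - 1 + 1)))) {0..a}"
      using False m by (intro has_integral_mult_right has_integral_powr_from_0) auto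
    then have hi: "((\<lambda>t. pi * (2/m) * t powr (2/m - 1)) has_integral (pi * a powr (2/m))) {0..a}"
      using m by simp
    have "emeasure (density lborel ?d) X = (\<integral>\<^sup>+ t. ennreal (indicator {0..a} t * (pi * (2/m) * t powr (2/m - 1))) \<partial>lborel)"
      unfolding X by (subst emeasure_density) (auto intro!: nn_integral_cong simp: indicator_def)
    also have "\<dots> = ennreal (pi * a powr (2/m))"
      by (rule nn_integral_has_integral_lebesgue[OF _ hi]) (use m in auto)
    finally show ?thesis using False fin[of a] X by simp
  qed
qed

text \<open>Euler's integral for \<open>Gamma p\<close> after the substitution of
  \<open>a * t\<close> for \<open>t\<close>.\<close>

lemma nn_integral_powr_exp:
  fixes p a :: real
  assumes "p > 0" "a > 0"
  shows "(\<integral>\<^sup>+ t. ennreal (indicator {0..} t * (t powr (p - 1) * exp (- a * t))) \<partial>lborel)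
    = ennreal (Gamma p / a powr p)"
proof -
  have "ennreal (Gamma p) = (\<integral>\<^sup>+ t. ennreal (indicator {0..} t * t powr (p - 1) / exp t) \<partial>lborel)"
    by (rule Gamma_conv_nn_integral_real) fact
  also have "\<dots> = ennreal a * (\<integral>\<^sup>+ t. ennreal (indicator {0..} (0 + a * t) * (0 + a * t) powr (p - 1) / exp (0 + a * t)) \<partial>lborel)"
    using assms by (subst nn_integral_real_affine[where c = a and t = 0]) simp_all
  also have "\<dots> = (\<integral>\<^sup>+ t. ennreal (a powr p) * ennreal (indicator {0..} t * (t powr (p - 1) * exp (- a * t))) \<partial>lborel)"
  proof (subst nn_integral_cmult[symmetric], measurable, rule nn_integral_cong)
    fix t :: real
    show "ennreal a * ennreal (indicator {0..} (0 + a * t) * (0 + a * t) powr (p - 1) / exp (0 + a * t)) =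
       ennreal (a powr p) * ennreal (indicator {0..} t * (t powr (p - 1) * exp (- a * t)))"
    proof (cases "t \<ge> 0")
      case True
      have "a * (a powr (p - 1)) = a powr p"
        using assms by (simp add: powr_diff)
      then show ?thesis using assms True
        by (simp add: ennreal_mult'[symmetric] powr_mult exp_minus field_simps)
    next
      case False
      then have "\<not> 0 \<le> a * t" using assms by (simp add: zero_le_mult_iff)
      then show ?thesis using False by simp
    qed
  qed
  also have "\<dots> = ennreal (a powr p) * (\<integral>\<^sup>+ t. ennreal (indicator {0..} t * (t powr (p - 1) * exp (- a * t))) \<partial>lborel)"
    by (rule nn_integral_cmult) measurable
  finally have *: "ennreal (Gamma p) = ennreal (a powr p) * (\<integral>\<^sup>+ t. ennreal (indicator {0..} t * (t powr (p - 1) * exp (- a * t))) \<partial>lborel)" (is "_ = _ * ?I") .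
  have "ennreal (Gamma p / a powr p) = ennreal (1 / a powr p) * ennreal (Gamma p)"
    using assms by (subst ennreal_mult'[symmetric]) auto
  also have "\<dots> = ennreal (1 / a powr p * a powr p) * ?I"
    unfolding * mult.assoc[symmetric] using assms by (subst ennreal_mult'[symmetric]) auto
  finally show ?thesis using assms by simp
qed

section \<open>Reproducing kernels of radial measures\<close>

lemma borel_measurable_cnj [measurable]: "cnj \<in> borel_measurable borel"
  by (intro borel_measurable_continuous_onI continuous_intros)

text \<open>What the kernel construction rests on: rotation invariance makes the monomials
  orthogonal, finite moments make them square integrable, and unbounded support makes the moments
  grow so fast that the kernel series is entire.\<close>

locale radial_measure =
  fixes M :: "complex measure"
  assumes sets_M [measurable_cong]: "sets M = sets borel"
    and rotation_invariant: "cmod u = 1 \<Longrightarrow> distr M borel ((*) u) = M"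
    and integrable_moment: "integrable M (\<lambda>w. cmod w ^ n)"
    and unbounded_support: "emeasure M {w. R < cmod w} \<noteq> 0"
begin

text \<open>The squared norm of the monomial of degree \<open>n\<close>, hence the exponent
  \<open>2 * n\<close>.\<close>

definition moment :: "nat \<Rightarrow> real" where
  "moment n = (\<integral>w. cmod w ^ (2 * n) \<partial>M)"

text \<open>The usual sum over an orthonormal system, here the normalized monomials.\<close>

definition kern :: "complex \<Rightarrow> complex \<Rightarrow> complex" where
  "kern w z = (\<Sum>n. (w * cnj z) ^ n / of_real (moment n))"

lemma space_M [simp]: "space M = UNIV"
  using sets_M by (metis sets_eq_imp_space_eq space_borel)

lemma finite_measure_M: "finite_measure M"
proof
  have "integrable M (\<lambda>_. 1::real)" using integrable_moment[of 0] by simp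
  then show "emeasure M (space M) \<noteq> \<infinity>"
    by (simp add: integrable_iff_bounded less_top)
qed

text \<open>The region \<open>sqrt A < cmod w\<close> has positive mass, and the integrand is at
  least \<open>A ^ n\<close> there. As \<open>A\<close> is arbitrary, the moments outgrow every
  geometric sequence.\<close>

lemma moment_growth:
  assumes "A > 0"
  obtains c where "c > 0" "\<And>n. c * A ^ n \<le> moment n"
proof -
  interpret finite_measure M by (rule finite_measure_M)
  define B where "B = {w. sqrt A < cmod w}"
  have B [measurable]: "B \<in> sets M" unfolding B_def sets_M by measurable
  have pos: "measure M B > 0"
    using unbounded_support[of "sqrt A"] unfolding B_def[symmetric]
    by (simp add: emeasure_eq_measure measure_nonneg order.strict_iff_order)
  have "measure M B * A ^ n \<le> moment n" for n
  proof -
    have "measure M B * A ^ n = (\<integral>w. A ^ n * indicator B w \<partial>M)" by simp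
    also have "\<dots> \<le> moment n"
      unfolding moment_def
    proof (rule integral_mono)
      show "integrable M (\<lambda>w. A ^ n * indicator B w)"
        by (intro integrable_mult_right integrable_real_indicator) (auto simp: less_top[symmetric])
      show "integrable M (\<lambda>w. cmod w ^ (2 * n))" by (rule integrable_moment)
      fix w
      show "A ^ n * indicator B w \<le> cmod w ^ (2 * n)"
      proof (cases "w \<in> B")
        case True
        then have "(sqrt A)\<^sup>2 \<le> (cmod w)\<^sup>2"
          using assms by (intro power_mono) (auto simp: B_def)
        then have "A ^ n \<le> ((cmod w)\<^sup>2) ^ n"
          using assms by (intro power_mono) auto
        then show ?thesis using True by (simp add: power_mult)
      qed simp
    qed
    finally show ?thesis .
  qed
  with pos show ?thesis using that by blast
qed

lemma moment_pos: "moment n > 0"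
proof -
  obtain c where "c > 0" "\<And>n. c * 1 ^ n \<le> moment n"
    using moment_growth[of 1] by auto
  then show ?thesis by (metis less_le_trans mult.right_neutral power_one)
qed

text \<open>\<open>sqrt (moment n)\<close> is the norm of a monomial; series of this type justify
  the termwise integrations in \<open>integrable_kern_square\<close> and
  \<open>kern_reproducing\<close>.\<close>

lemma summable_power_div_sqrt_moment:
  assumes "x \<ge> 0"
  shows "summable (\<lambda>n. x ^ n / sqrt (moment n))"
proof -
  \<comment> \<open>The square of a number larger than \<open>x\<close>: dividing by its root leaves
    a geometric series with ratio below 1.\<close>
  define A where "A = (2 * x + 1)\<^sup>2"
  have A: "A > 0" using assms by (simp add: A_def)
  obtain c where c: "c > 0" "\<And>n. c * A ^ n \<le> moment n"
    using moment_growth[OF A] by blast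
  show ?thesis
  proof (rule summable_comparison_test')
    show "summable (\<lambda>n. 1 / sqrt c * (x / (2 * x + 1)) ^ n)"
      using assms by (intro summable_mult summable_geometric) auto
    fix n :: nat
    have "sqrt c * (2 * x + 1) ^ n = sqrt (c * A ^ n)"
      using assms by (simp add: A_def real_sqrt_mult real_sqrt_power)
    also have "\<dots> \<le> sqrt (moment n)" using c by simp
    finally have le: "sqrt c * (2 * x + 1) ^ n \<le> sqrt (moment n)" .
    have "x ^ n / sqrt (moment n) \<le> x ^ n / (sqrt c * (2 * x + 1) ^ n)"
      using assms c(1) by (intro divide_left_mono le mult_pos_pos) (auto simp: moment_pos)
    also have "\<dots> = 1 / sqrt c * (x / (2 * x + 1)) ^ n"
      by (simp add: power_divide)
    finally show "norm (x ^ n / sqrt (moment n)) \<le> 1 / sqrt c * (x / (2 * x + 1)) ^ n"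
      using assms moment_pos[of n] by (simp add: less_imp_le)
  qed
qed

text \<open>The terms are the squares of those of the preceding series at \<open>sqrt x\<close>,
  which are eventually below 1.\<close>

lemma summable_power_div_moment:
  assumes "x \<ge> 0"
  shows "summable (\<lambda>n. x ^ n / moment n)"
proof -
  have "summable (\<lambda>n. sqrt x ^ n / sqrt (moment n))"
    using assms by (intro summable_power_div_sqrt_moment) simp
  then have "(\<lambda>n. sqrt x ^ n / sqrt (moment n)) \<longlonglongrightarrow> 0" by (rule summable_LIMSEQ_zero)
  then have "eventually (\<lambda>n. sqrt x ^ n / sqrt (moment n) < 1) sequentially"
    by (rule order_tendstoD) simp
  then have "eventually (\<lambda>n. norm (x ^ n / moment n) \<le> sqrt x ^ n / sqrt (moment n)) sequentially"
  proof eventually_elim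
    case (elim n)
    define y where "y = sqrt x ^ n / sqrt (moment n)"
    have "y \<ge> 0" using assms moment_pos[of n] by (simp add: y_def less_imp_le)
    moreover have "x ^ n / moment n = y ^ 2"
      using assms moment_pos[of n]
      by (simp add: y_def power_divide power_mult[symmetric] mult.commute[of n]) (simp add: power_mult)
    ultimately show ?case
      using elim unfolding y_def[symmetric] by (simp add: power2_eq_square mult_left_le)
  qed
  then show ?thesis
    by (rule summable_comparison_test_ev) fact
qed

lemma kern_summable_norm: "summable (\<lambda>n. norm ((w * cnj z) ^ n / of_real (moment n)))"
  using summable_power_div_moment[of "cmod w * cmod z"] moment_pos
  by (simp add: norm_divide norm_mult norm_power less_imp_le)

lemma kern_summable: "summable (\<lambda>n. (w * cnj z) ^ n / of_real (moment n))"
  using kern_summable_norm by (rule summable_norm_cancel)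

lemma cnj_kern: "cnj (kern w z) = kern z w"
proof -
  have "(\<lambda>n. cnj ((w * cnj z) ^ n / of_real (moment n))) sums cnj (kern w z)"
    unfolding sums_cnj kern_def by (rule summable_sums) (rule kern_summable)
  then have "(\<lambda>n. (z * cnj w) ^ n / of_real (moment n)) sums cnj (kern w z)"
    by (simp add: mult.commute)
  then show ?thesis unfolding kern_def by (simp add: sums_iff)
qed

lemma kern_holomorphic: "(\<lambda>w. kern w z) holomorphic_on UNIV"
proof -
  have eq: "(w * cnj z) ^ n / of_real (moment n) = (cnj z ^ n / of_real (moment n)) * w ^ n" for w n
    by (simp add: power_mult_distrib)
  have "((\<lambda>w. \<Sum>n. (cnj z ^ n / of_real (moment n)) * w ^ n) has_field_derivative
      (\<Sum>n. diffs (\<lambda>n. cnj z ^ n / of_real (moment n)) n * w ^ n)) (at w)" for w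
    by (rule termdiffs_strong_converges_everywhere) (use kern_summable[of _ z] in \<open>simp add: eq\<close>)
  then show ?thesis
    unfolding kern_def eq holomorphic_on_open[OF open_UNIV] by blast
qed

lemma borel_measurable_kern [measurable]: "(\<lambda>w. kern w z) \<in> borel_measurable borel"
  by (intro borel_measurable_continuous_onI holomorphic_on_imp_continuous_on kern_holomorphic)

text \<open>The majorant \<open>S * G\<close> is integrable because the weights
  \<open>c n * \<nu> n\<close> are balanced: integrating the \<open>n\<close>-th term of
  \<open>G\<close> returns exactly \<open>c n * \<nu> n\<close>, and these sum to
  \<open>S\<close>.\<close>

lemma integrable_kern_square: "integrable M (\<lambda>w. (cmod (kern w z))\<^sup>2)"
proof -
  define c where "c n = cmod z ^ n / moment n" for n
  define \<nu> where "\<nu> n = sqrt (moment n)" for n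
  have \<nu>: "\<nu> n > 0" "\<nu> n ^ 2 = moment n" for n
    using moment_pos[of n] by (auto simp: \<nu>_def)
  have c: "c n \<ge> 0" for n using moment_pos[of n] by (simp add: c_def less_imp_le)
  have c\<nu>: "c n * \<nu> n = cmod z ^ n / sqrt (moment n)" for n
    using \<nu>[of n] unfolding c_def by (simp add: \<nu>_def field_simps)
  have S: "summable (\<lambda>n. c n * \<nu> n)"
    unfolding c\<nu> by (rule summable_power_div_sqrt_moment) simp
  define S where "S = (\<Sum>n. c n * \<nu> n)"
  have S_pos: "S > 0"
    unfolding S_def
  proof (rule suminf_pos2[OF \<open>summable (\<lambda>n. c n * \<nu> n)\<close>, where i = 0])
    show "c n * \<nu> n \<ge> 0" for n using c[of n] \<nu>[of n] by simp
    show "0 < c 0 * \<nu> 0" using \<nu>[of 0] moment_pos[of 0] by (simp add: c_def)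
  qed
  \<comment> \<open>Growth with base 1 only says that \<open>\<nu> n\<close> stays above
    \<open>sqrt b\<close>; this makes \<open>G\<close> converge pointwise by comparison with
    \<open>sum1\<close> at the square of \<open>w\<close>.\<close>
  obtain b where b: "b > 0" "\<And>n. b * 1 ^ n \<le> moment n"
    using moment_growth[of 1] by auto
  have sum1: "summable (\<lambda>n. c n * cmod w ^ n)" for w
    using summable_power_div_moment[of "cmod z * cmod w"] by (simp add: c_def power_mult_distrib mult.commute)
  have sum2: "summable (\<lambda>n. c n * cmod w ^ (2 * n) / \<nu> n)" for w
  proof (rule summable_comparison_test')
    have "summable (\<lambda>n. c n * cmod (w\<^sup>2) ^ n)" by (rule sum1)
    then show "summable (\<lambda>n. 1 / sqrt b * (c n * cmod w ^ (2 * n)))"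
      by (intro summable_mult) (simp add: norm_power power_mult)
    fix n :: nat
    have "sqrt b \<le> \<nu> n" using b(2)[of n] by (simp add: \<nu>_def)
    then have "c n * cmod w ^ (2 * n) / \<nu> n \<le> c n * cmod w ^ (2 * n) / sqrt b"
      using c[of n] b(1) \<nu>[of n] by (intro divide_left_mono) auto
    then show "norm (c n * cmod w ^ (2 * n) / \<nu> n) \<le> 1 / sqrt b * (c n * cmod w ^ (2 * n))"
      using c[of n] \<nu>[of n] by (simp add: abs_mult less_imp_le)
  qed
  define G where "G w = (\<Sum>n. c n * cmod w ^ (2 * n) / \<nu> n)" for w
  have int_G: "integrable M G"
    unfolding G_def
  proof (rule integrable_suminf)
    show "integrable M (\<lambda>w. c n * cmod w ^ (2 * n) / \<nu> n)" for n
      by (intro integrable_divide integrable_mult_right integrable_moment)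
    show "AE w in M. summable (\<lambda>n. norm (c n * cmod w ^ (2 * n) / \<nu> n))"
      using sum2 c \<nu>(1) by (simp add: less_imp_le)
    have "(\<integral>w. norm (c n * cmod w ^ (2 * n) / \<nu> n) \<partial>M) = c n * \<nu> n" for n
    proof -
      have "(\<integral>w. norm (c n * cmod w ^ (2 * n) / \<nu> n) \<partial>M) = (\<integral>w. c n / \<nu> n * cmod w ^ (2 * n) \<partial>M)"
        using c \<nu>(1) by (simp add: less_imp_le)
      also have "\<dots> = c n / \<nu> n * \<nu> n ^ 2" by (simp add: moment_def[symmetric] \<nu>)
      finally show ?thesis using \<nu>(1)[of n] by (simp add: power2_eq_square)
    qed
    then show "summable (\<lambda>n. \<integral>w. norm (c n * cmod w ^ (2 * n) / \<nu> n) \<partial>M)"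
      using S by simp
  qed
  (* Cauchy-Schwarz for the weights c n * \<nu> n, as nonnegativity of the weighted variance of cmod w ^ n / \<nu> n *)
  have bound: "(cmod (kern w z))\<^sup>2 \<le> S * G w" for w
  proof -
    define X where "X = (\<Sum>n. c n * cmod w ^ n)"
    have X_ge: "X \<ge> 0" unfolding X_def using c by (intro suminf_nonneg sum1) simp
    have "cmod (kern w z) \<le> (\<Sum>n. norm ((w * cnj z) ^ n / of_real (moment n)))"
      unfolding kern_def by (rule summable_norm) (rule kern_summable_norm)
    also have "\<dots> = X"
      unfolding X_def c_def using moment_pos
      by (intro suminf_cong) (simp add: norm_divide norm_mult norm_power power_mult_distrib less_imp_le)
    finally have 1: "cmod (kern w z) \<le> X" .
    have "(\<lambda>n. c n * cmod w ^ (2 * n) / \<nu> n - 2 * X / S * (c n * cmod w ^ n) + (X / S)\<^sup>2 * (c n * \<nu> n))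
        sums (G w - 2 * X / S * X + (X / S)\<^sup>2 * S)"
      unfolding G_def X_def S_def
      by (intro sums_add sums_diff sums_mult summable_sums sum1 sum2 S)
    moreover have "c n * cmod w ^ (2 * n) / \<nu> n - 2 * X / S * (c n * cmod w ^ n) + (X / S)\<^sup>2 * (c n * \<nu> n)
        = c n * \<nu> n * (cmod w ^ n / \<nu> n - X / S)\<^sup>2" for n
      using \<nu>(1)[of n] S_pos by (simp add: power2_eq_square field_simps power_mult power_even_eq)
    moreover have "c n * \<nu> n * (cmod w ^ n / \<nu> n - X / S)\<^sup>2 \<ge> 0" for n
      using c[of n] \<nu>(1)[of n] by simp
    ultimately have "G w - 2 * X / S * X + (X / S)\<^sup>2 * S \<ge> 0"
      by (metis (no_types, lifting) sums_le sums_zero)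
    then have "X\<^sup>2 \<le> S * G w"
      using S_pos by (simp add: power2_eq_square field_simps)
    moreover have "(cmod (kern w z))\<^sup>2 \<le> X\<^sup>2" using 1 by (intro power_mono) auto
    ultimately show ?thesis by simp
  qed
  show ?thesis
  proof (rule Bochner_Integration.integrable_bound)
    show "integrable M (\<lambda>w. S * G w)" using int_G by simp
    show "AE w in M. norm ((cmod (kern w z))\<^sup>2) \<le> norm (S * G w)"
      using bound by (intro AE_I2) (auto intro: order_trans abs_ge_self)
  qed measurable
qed

text \<open>Rotation by \<open>pi / (k - n)\<close> preserves the measure and the disc but changes
  the sign of the integrand, so the integral equals its own negative. Truncation to a disc is needed
  later, where Taylor series are integrated termwise.\<close>

lemma integral_monomials_disc:
  assumes "k \<noteq> n"
  shows "(\<integral>w. indicator (cball 0 R) w *\<^sub>R (w ^ k * cnj w ^ n) \<partial>M) = 0" (is "integral\<^sup>L M ?h = 0")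
proof -
  define u where "u = cis (pi / (real k - real n))"
  have "u ^ k * cnj u ^ n = cis (real k * (pi / (real k - real n))) * cis (real n * (- (pi / (real k - real n))))"
    unfolding u_def cis_cnj Complex.DeMoivre ..
  also have "\<dots> = cis ((real k - real n) * (pi / (real k - real n)))"
    by (simp add: cis_mult algebra_simps diff_divide_distrib)
  also have "\<dots> = -1" using assms by simp
  finally have u: "u ^ k * cnj u ^ n = -1" .
  have neg: "?h (u * w) = - ?h w" for w
  proof -
    have "(u * w) ^ k * cnj (u * w) ^ n = (u ^ k * cnj u ^ n) * (w ^ k * cnj w ^ n)"
      by (simp add: power_mult_distrib mult_ac)
    moreover have "cmod u = 1" by (simp add: u_def)
    ultimately show ?thesis by (simp add: u indicator_def norm_mult)
  qed
  have "integral\<^sup>L M ?h = integral\<^sup>L (distr M borel ((*) u)) ?h"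
    using rotation_invariant[of u] by (simp add: u_def)
  also have "\<dots> = (\<integral>w. ?h (u * w) \<partial>M)"
    by (rule integral_distr) (measurable, simp_all add: measurable_cong_sets[OF sets_M refl])
  also have "\<dots> = - integral\<^sup>L M ?h"
    unfolding neg by (rule integral_minus)
  finally show ?thesis by simp
qed

text \<open>The inequality between arithmetic and geometric means, scaled by
  \<open>\<nu> = sqrt (moment n)\<close> so that the bound is linear in \<open>\<nu>\<close>. This
  rate makes the series in \<open>kern_reproducing\<close> converge.\<close>

lemma integrable_norm_mult_power:
  assumes [measurable]: "f \<in> borel_measurable borel"
    and f: "integrable M (\<lambda>w. (cmod (f w))\<^sup>2)"
  shows "integrable M (\<lambda>w. cmod (f w) * cmod w ^ n)"
    and "(\<integral>w. cmod (f w) * cmod w ^ n \<partial>M)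
      \<le> sqrt (moment n) * (((\<integral>w. (cmod (f w))\<^sup>2 \<partial>M) + 1) / 2)"
proof -
  define \<nu> where "\<nu> = sqrt (moment n)"
  have \<nu>: "\<nu> > 0" "\<nu> ^ 2 = moment n"
    using moment_pos[of n] by (auto simp: \<nu>_def)
  define G where "G w = (\<nu> * (cmod (f w))\<^sup>2 + cmod w ^ (2 * n) / \<nu>) / 2" for w
  have G: "integrable M G"
    unfolding G_def using f integrable_moment[of "2 * n"] by simp
  have le: "cmod (f w) * cmod w ^ n \<le> G w" for w
  proof -
    have "0 \<le> (\<nu> * cmod (f w) - cmod w ^ n)\<^sup>2 / \<nu>" using \<nu> by simp
    then show ?thesis using \<nu>(1)
      by (simp add: G_def power2_eq_square field_simps power_mult power_even_eq)
  qed
  show int: "integrable M (\<lambda>w. cmod (f w) * cmod w ^ n)"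
  proof (rule Bochner_Integration.integrable_bound[OF G])
    show "AE w in M. norm (cmod (f w) * cmod w ^ n) \<le> norm (G w)"
      using le by (intro AE_I2) (auto intro: order_trans abs_ge_self)
  qed measurable
  have "(\<integral>w. cmod (f w) * cmod w ^ n \<partial>M) \<le> (\<integral>w. G w \<partial>M)"
    by (rule integral_mono[OF int G]) (rule le)
  also have "\<dots> = (\<nu> * (\<integral>w. (cmod (f w))\<^sup>2 \<partial>M) + moment n / \<nu>) / 2"
    unfolding G_def moment_def using f integrable_moment[of "2 * n"] by simp
  also have "moment n / \<nu> = \<nu>"
    using \<nu> by (metis less_irrefl nonzero_mult_div_cancel_left power2_eq_square)
  finally show "(\<integral>w. cmod (f w) * cmod w ^ n \<partial>M)
      \<le> sqrt (moment n) * (((\<integral>w. (cmod (f w))\<^sup>2 \<partial>M) + 1) / 2)"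
    by (simp add: \<nu>_def algebra_simps)
qed

text \<open>On a disc the Taylor series of \<open>f\<close> is dominated by a convergent series of
  constants and may be integrated termwise; orthogonality leaves only degree \<open>n\<close>.
  Dominated convergence then lets the radius tend to infinity on both sides.\<close>

lemma integral_mult_cnj_power:
  assumes hol: "f holomorphic_on UNIV" and f: "integrable M (\<lambda>w. (cmod (f w))\<^sup>2)"
  shows "(\<integral>w. f w * cnj w ^ n \<partial>M) = (deriv ^^ n) f 0 / fact n * moment n"
proof -
  define a where "a k = (deriv ^^ k) f 0 / fact k" for k
  have sums: "(\<lambda>k. a k * w ^ k) sums f w" for w
    using holomorphic_power_series[of f 0 "cmod w + 1" w] hol
    by (auto simp: a_def intro: holomorphic_on_subset)
  have [measurable]: "f \<in> borel_measurable borel"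
    by (intro borel_measurable_continuous_onI holomorphic_on_imp_continuous_on hol)
  interpret finite_measure M by (rule finite_measure_M)
  have abs_sum: "summable (\<lambda>k. norm (a k) * r ^ k)" if "r \<ge> 0" for r :: real
  proof -
    have "summable (\<lambda>k. norm (a k * of_real r ^ k))"
      using sums[of "of_real (r + 1)"] that
      by (intro powser_insidea[where x = "of_real (r + 1)"]) (auto simp: sums_iff simp del: of_real_add)
    then show ?thesis using that by (simp add: norm_mult norm_power)
  qed
  have disc: "(\<integral>w. indicator (cball 0 R) w *\<^sub>R (f w * cnj w ^ n) \<partial>M)
      = a n * (\<integral>w. indicator (cball 0 R) w *\<^sub>R (w ^ n * cnj w ^ n) \<partial>M)" if R: "R \<ge> 0" for R
  proof -
    let ?g = "\<lambda>k w. a k * (indicator (cball 0 R) w *\<^sub>R (w ^ k * cnj w ^ n))"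
    have bd: "norm (?g k w) \<le> norm (a k) * R ^ k * R ^ n" for k w
    proof (cases "w \<in> cball 0 R")
      case True
      then have "cmod w ^ k \<le> R ^ k" "cmod w ^ n \<le> R ^ n" by (auto intro: power_mono)
      then have "cmod (a k) * (cmod w ^ k * cmod w ^ n) \<le> cmod (a k) * (R ^ k * R ^ n)"
        using R by (intro mult_left_mono mult_mono) auto
      then show ?thesis using True by (simp add: norm_mult norm_power mult_ac)
    qed (use R in auto)
    have meas: "?g k \<in> borel_measurable M" for k
    proof -
      have "(\<lambda>w. w ^ k * cnj w ^ n) \<in> borel_measurable borel"
        by (intro borel_measurable_continuous_onI continuous_intros)
      then show ?thesis
        unfolding measurable_cong_sets[OF sets_M refl]
        by (intro borel_measurable_times borel_measurable_const borel_measurable_scaleR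
            borel_measurable_indicator) auto
    qed
    have int: "integrable M (?g k)" for k
      by (rule integrable_const_bound[where B = "norm (a k) * R ^ k * R ^ n"], intro AE_I2 bd) (rule meas)
    have "(\<lambda>k. integral\<^sup>L M (?g k)) sums (\<integral>w. (\<Sum>k. ?g k w) \<partial>M)"
    proof (rule sums_integral[OF int])
      show "AE w in M. summable (\<lambda>k. norm (?g k w))"
        by (intro AE_I2 summable_comparison_test'[OF summable_mult2[OF abs_sum[OF R], of "R ^ n"]])
           (use bd in auto)
      show "summable (\<lambda>k. \<integral>w. norm (?g k w) \<partial>M)"
      proof (rule summable_comparison_test')
        show "summable (\<lambda>k. norm (a k) * R ^ k * (R ^ n * measure M (space M)))"
          by (intro summable_mult2 abs_sum R)
        fix k
        have "(\<integral>w. norm (?g k w) \<partial>M) \<le> (\<integral>w. norm (a k) * R ^ k * R ^ n \<partial>M)"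
          by (rule integral_mono[OF integrable_norm[OF int] _ bd]) simp
        then show "norm (\<integral>w. norm (?g k w) \<partial>M) \<le> norm (a k) * R ^ k * (R ^ n * measure M (space M))"
          by (simp add: integral_nonneg_AE mult_ac del: space_M)
      qed
    qed
    moreover have "integral\<^sup>L M (?g k) = (if k = n then a n * (\<integral>w. indicator (cball 0 R) w *\<^sub>R (w ^ n * cnj w ^ n) \<partial>M) else 0)" for k
    proof -
      have "integral\<^sup>L M (?g k) = a k * (\<integral>w. indicator (cball 0 R) w *\<^sub>R (w ^ k * cnj w ^ n) \<partial>M)"
        by (rule integral_mult_right_zero)
      then show ?thesis using integral_monomials_disc[of k n R] by simp
    qed
    moreover have "(\<Sum>k. ?g k w) = indicator (cball 0 R) w *\<^sub>R (f w * cnj w ^ n)" for w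
    proof -
      have "(\<lambda>k. indicator (cball 0 R) w *\<^sub>R ((a k * w ^ k) * cnj w ^ n)) sums (indicator (cball 0 R) w *\<^sub>R (f w * cnj w ^ n))"
        by (intro sums_scaleR_right sums_mult2 sums)
      then show ?thesis by (simp add: sums_iff mult_ac)
    qed
    ultimately show ?thesis
      using sums_single[of n "\<lambda>_. a n * (\<integral>w. indicator (cball 0 R) w *\<^sub>R (w ^ n * cnj w ^ n) \<partial>M)"]
      by (auto dest: sums_unique2)
  qed
  have cnj_pow: "(\<lambda>w. cnj w ^ n) \<in> borel_measurable borel"
    by (intro borel_measurable_continuous_onI continuous_intros)
  have exhaust: "(\<lambda>i. \<integral>w. indicator (cball 0 (real i)) w *\<^sub>R h w \<partial>M) \<longlonglongrightarrow> integral\<^sup>L M h"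
    if h: "h \<in> borel_measurable borel" and int: "integrable M (\<lambda>w. cmod (h w))" for h :: "complex \<Rightarrow> complex"
  proof (rule integral_dominated_convergence[OF _ _ int])
    show "h \<in> borel_measurable M"
      using h by (simp add: measurable_cong_sets[OF sets_M refl])
    show "(\<lambda>w. indicator (cball 0 (real i)) w *\<^sub>R h w) \<in> borel_measurable M" for i
      unfolding measurable_cong_sets[OF sets_M refl]
      by (intro borel_measurable_scaleR borel_measurable_indicator h) auto
    show "AE w in M. norm (indicator (cball 0 (real i)) w *\<^sub>R h w) \<le> cmod (h w)" for i
      by (intro AE_I2) (simp add: indicator_def)
    show "AE w in M. (\<lambda>i. indicator (cball 0 (real i)) w *\<^sub>R h w) \<longlonglongrightarrow> h w"
    proof (intro AE_I2 tendsto_eventually)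
      fix w :: complex
      obtain i0 where "cmod w \<le> real i0" using real_arch_simple by blast
      then show "eventually (\<lambda>i. indicator (cball 0 (real i)) w *\<^sub>R h w = h w) sequentially"
        by (intro eventually_sequentiallyI[of i0]) (auto simp: indicator_def)
    qed
  qed
  have "(\<lambda>i. \<integral>w. indicator (cball 0 (real i)) w *\<^sub>R (f w * cnj w ^ n) \<partial>M) \<longlonglongrightarrow> (\<integral>w. f w * cnj w ^ n \<partial>M)"
    using integrable_norm_mult_power(1)[of f n] f cnj_pow
    by (intro exhaust) (auto simp: norm_mult norm_power)
  moreover have "(\<lambda>i. a n * (\<integral>w. indicator (cball 0 (real i)) w *\<^sub>R (w ^ n * cnj w ^ n) \<partial>M)) \<longlonglongrightarrow> a n * (\<integral>w. w ^ n * cnj w ^ n \<partial>M)"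
    using integrable_moment[of "2 * n"] cnj_pow
    by (intro tendsto_mult_left exhaust) (auto simp: norm_mult norm_power mult_2 power_add)
  ultimately have "(\<integral>w. f w * cnj w ^ n \<partial>M) = a n * (\<integral>w. w ^ n * cnj w ^ n \<partial>M)"
    using disc by (auto intro: LIMSEQ_unique)
  also have "w ^ n * cnj w ^ n = complex_of_real (cmod w ^ (2 * n))" for w
    using complex_norm_square[of w] by (simp add: power_mult flip: power_mult_distrib)
  then have "(\<integral>w. w ^ n * cnj w ^ n \<partial>M) = complex_of_real (moment n)"
    by (simp add: moment_def del: of_real_power)
  finally show ?thesis by (simp add: a_def)
qed

text \<open>Expanding the conjugated kernel, each term yields a Taylor coefficient of
  \<open>f\<close> times a moment that cancels against the kernel coefficient; what remains is the
  Taylor series of \<open>f\<close> at \<open>z\<close>.\<close>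

lemma kern_reproducing:
  assumes hol: "f holomorphic_on UNIV" and f: "integrable M (\<lambda>w. (cmod (f w))\<^sup>2)"
  shows "(\<integral>w. f w * cnj (kern w z) \<partial>M) = f z"
proof -
  have [measurable]: "f \<in> borel_measurable borel"
    by (intro borel_measurable_continuous_onI holomorphic_on_imp_continuous_on hol)
  let ?g = "\<lambda>n w. f w * cnj w ^ n * (z ^ n / of_real (moment n))"
  have norm_g: "norm (?g n w) = (cmod z ^ n / moment n) * (cmod (f w) * cmod w ^ n)" for n w
    using moment_pos[of n] by (simp add: norm_mult norm_divide norm_power)
  have int: "integrable M (?g n)" for n
  proof (rule Bochner_Integration.integrable_bound)
    show "integrable M (\<lambda>w. (cmod z ^ n / moment n) * (cmod (f w) * cmod w ^ n))"
      using f by (intro integrable_mult_right integrable_norm_mult_power) auto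
    show "AE w in M. norm (?g n w) \<le> norm ((cmod z ^ n / moment n) * (cmod (f w) * cmod w ^ n))"
      unfolding norm_g real_norm_def by (intro AE_I2 abs_ge_self)
  qed measurable
  define F where "F = ((\<integral>w. (cmod (f w))\<^sup>2 \<partial>M) + 1) / 2"
  have "(\<lambda>n. integral\<^sup>L M (?g n)) sums (\<integral>w. (\<Sum>n. ?g n w) \<partial>M)"
  proof (rule sums_integral[OF int])
    show "AE w in M. summable (\<lambda>n. norm (?g n w))"
    proof (rule AE_I2)
      fix w
      have "summable (\<lambda>n. (cmod z * cmod w) ^ n / moment n * cmod (f w))"
        by (intro summable_mult2 summable_power_div_moment) simp
      then show "summable (\<lambda>n. norm (?g n w))"
        unfolding norm_g by (simp add: power_mult_distrib mult_ac)
    qed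
    show "summable (\<lambda>n. \<integral>w. norm (?g n w) \<partial>M)"
    proof (rule summable_comparison_test')
      show "summable (\<lambda>n. cmod z ^ n / sqrt (moment n) * F)"
        by (intro summable_mult2 summable_power_div_sqrt_moment) simp
      fix n
      have "(\<integral>w. norm (?g n w) \<partial>M) = cmod z ^ n / moment n * (\<integral>w. cmod (f w) * cmod w ^ n \<partial>M)"
        unfolding norm_g by simp
      also have "\<dots> \<le> cmod z ^ n / moment n * (sqrt (moment n) * F)"
        unfolding F_def using moment_pos[of n] f
        by (intro mult_left_mono integrable_norm_mult_power) auto
      also have "\<dots> = cmod z ^ n / sqrt (moment n) * F"
        using moment_pos[of n] by (simp add: field_simps flip: power2_eq_square)
      finally show "norm (\<integral>w. norm (?g n w) \<partial>M) \<le> cmod z ^ n / sqrt (moment n) * F"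
        by (simp add: integral_nonneg_AE)
    qed
  qed
  moreover have "integral\<^sup>L M (?g n) = (deriv ^^ n) f 0 / fact n * z ^ n" for n
    using integral_mult_cnj_power[OF hol f, of n] moment_pos[of n] by simp
  moreover have "(\<Sum>n. ?g n w) = f w * cnj (kern w z)" for w
  proof -
    have "(\<lambda>n. f w * ((z * cnj w) ^ n / of_real (moment n))) sums (f w * kern z w)"
      unfolding kern_def by (intro sums_mult summable_sums kern_summable)
    then show ?thesis unfolding cnj_kern by (simp add: sums_iff power_mult_distrib mult_ac)
  qed
  moreover have "(\<lambda>n. (deriv ^^ n) f 0 / fact n * z ^ n) sums f z"
    using holomorphic_power_series[of f 0 "cmod z + 1" z] hol
    by (auto intro: holomorphic_on_subset)
  ultimately show ?thesis by (auto dest: sums_unique2)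
qed

end

section \<open>The Fock space kernel\<close>

definition fock_density :: "real \<Rightarrow> real \<Rightarrow> complex \<Rightarrow> real" where
  "fock_density \<alpha> m z = m * \<alpha> powr (2 / m) / (2 * pi * Gamma (2 / m)) * exp (- \<alpha> * cmod z powr m)"

text \<open>The Borel counterpart of \<open>fock_measure\<close>: the locale
  \<open>radial_measure\<close> and the product measures below work on Borel sets, while
  \<open>fock_measure\<close> lives on the Lebesgue completion.\<close>

definition fock_borel :: "real \<Rightarrow> real \<Rightarrow> complex measure" where
  "fock_borel \<alpha> m = density lborel (\<lambda>z. ennreal (fock_density \<alpha> m z))"

lemma borel_measurable_fock_density [measurable]: "fock_density \<alpha> m \<in> borel_measurable borel"
  unfolding fock_density_def[abs_def] by measurable

lemma fock_density_pos: "m > 0 \<Longrightarrow> \<alpha> > 0 \<Longrightarrow> fock_density \<alpha> m z > 0"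
  unfolding fock_density_def by (intro mult_pos_pos divide_pos_pos Gamma_real_pos) auto

lemma fock_density_nonneg: "m > 0 \<Longrightarrow> \<alpha> > 0 \<Longrightarrow> 0 \<le> fock_density \<alpha> m z"
  using fock_density_pos[of m \<alpha> z] by simp

lemma sets_fock_borel [measurable_cong]: "sets (fock_borel \<alpha> m) = sets borel"
  by (simp add: fock_borel_def)

lemma fock_measure_eq: "fock_measure \<alpha> m = density lebesgue (\<lambda>z. ennreal (fock_density \<alpha> m z))"
  by (simp add: fock_measure_def fock_density_def)

lemma
  fixes f :: "complex \<Rightarrow> 'a :: {banach, second_countable_topology}"
  assumes "m > 0" "\<alpha> > 0" "f \<in> borel_measurable lebesgue"
  shows integrable_fock_measure:
      "integrable (fock_measure \<alpha> m) f \<longleftrightarrow> integrable lebesgue (\<lambda>z. fock_density \<alpha> m z *\<^sub>R f z)"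
    and integral_fock_measure:
      "integral\<^sup>L (fock_measure \<alpha> m) f = integral\<^sup>L lebesgue (\<lambda>z. fock_density \<alpha> m z *\<^sub>R f z)"
proof -
  have *: "fock_density \<alpha> m \<in> borel_measurable lebesgue"
    using borel_measurable_fock_density by (simp add: measurable_completion)
  show "integrable (fock_measure \<alpha> m) f \<longleftrightarrow> integrable lebesgue (\<lambda>z. fock_density \<alpha> m z *\<^sub>R f z)"
    unfolding fock_measure_eq using assms
    by (intro integrable_density *) (auto simp: fock_density_nonneg)
  show "integral\<^sup>L (fock_measure \<alpha> m) f = integral\<^sup>L lebesgue (\<lambda>z. fock_density \<alpha> m z *\<^sub>R f z)"
    unfolding fock_measure_eq using assms
    by (intro integral_density *) (auto simp: fock_density_nonneg)
qed

lemma
  fixes f :: "complex \<Rightarrow> 'a :: {banach, second_countable_topology}"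
  assumes "m > 0" "\<alpha> > 0" and f [measurable]: "f \<in> borel_measurable borel"
  shows integrable_fock_borel:
      "integrable (fock_borel \<alpha> m) f \<longleftrightarrow> integrable lborel (\<lambda>z. fock_density \<alpha> m z *\<^sub>R f z)"
    and integral_fock_borel:
      "integral\<^sup>L (fock_borel \<alpha> m) f = integral\<^sup>L lborel (\<lambda>z. fock_density \<alpha> m z *\<^sub>R f z)"
    and integrable_fock_measure_borel:
      "integrable (fock_measure \<alpha> m) f \<longleftrightarrow> integrable (fock_borel \<alpha> m) f"
    and integral_fock_measure_borel:
      "integral\<^sup>L (fock_measure \<alpha> m) f = integral\<^sup>L (fock_borel \<alpha> m) f"
proof -
  have leb: "f \<in> borel_measurable lebesgue"
    using f by (simp add: measurable_completion)
  show 1: "integrable (fock_borel \<alpha> m) f \<longleftrightarrow> integrable lborel (\<lambda>z. fock_density \<alpha> m z *\<^sub>R f z)"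
    unfolding fock_borel_def using assms
    by (intro integrable_density) (auto simp: fock_density_nonneg)
  show 2: "integral\<^sup>L (fock_borel \<alpha> m) f = integral\<^sup>L lborel (\<lambda>z. fock_density \<alpha> m z *\<^sub>R f z)"
    unfolding fock_borel_def using assms
    by (intro integral_density) (auto simp: fock_density_nonneg)
  show "integrable (fock_measure \<alpha> m) f \<longleftrightarrow> integrable (fock_borel \<alpha> m) f"
    unfolding 1 integrable_fock_measure[OF assms(1,2) leb]
    by (rule integrable_completion) measurable
  show "integral\<^sup>L (fock_measure \<alpha> m) f = integral\<^sup>L (fock_borel \<alpha> m) f"
    unfolding 2 integral_fock_measure[OF assms(1,2) leb]
    by (rule integral_completion) measurable
qed

text \<open>Passing to the variable \<open>t = cmod w powr m\<close> turns the moment into a Gamma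
  integral.\<close>

lemma nn_integral_fock_moment:
  assumes m: "m > 0" and \<alpha>: "\<alpha> > 0"
  shows "(\<integral>\<^sup>+ w. ennreal (cmod w ^ n) \<partial>fock_borel \<alpha> m)
    = ennreal (Gamma ((real n + 2) / m) / (Gamma (2 / m) * \<alpha> powr (real n / m)))"
proof -
  define C where "C = m * \<alpha> powr (2 / m) / (2 * pi * Gamma (2 / m))"
  have G: "Gamma (2 / m) > 0" using m by (intro Gamma_real_pos) simp
  have C: "C > 0" unfolding C_def using m \<alpha> G by (intro mult_pos_pos divide_pos_pos) auto
  define h where "h = (\<lambda>t. ennreal (C * (t powr (real n / m) * exp (- \<alpha> * t))))"
  have [measurable]: "h \<in> borel_measurable borel" unfolding h_def by measurable
  have "(\<integral>\<^sup>+ w. ennreal (cmod w ^ n) \<partial>fock_borel \<alpha> m)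
    = (\<integral>\<^sup>+ w. ennreal (fock_density \<alpha> m w) * ennreal (cmod w ^ n) \<partial>lborel)"
    unfolding fock_borel_def by (rule nn_integral_density) measurable
  also have "\<dots> = (\<integral>\<^sup>+ w. h (cmod w powr m) \<partial>lborel)"
  proof (rule nn_integral_cong_AE)
    \<comment> \<open>The origin has to be left out: for \<open>n = 0\<close> the power
      \<open>cmod w ^ n\<close> is 1 there, whereas \<open>0 powr 0\<close> is 0.\<close>
    have "AE w in lborel. w \<noteq> (0::complex)" by (rule AE_lborel_singleton)
    then show "AE w in lborel. ennreal (fock_density \<alpha> m w) * ennreal (cmod w ^ n) = h (cmod w powr m)"
    proof eventually_elim
      case (elim w)
      have "(cmod w powr m) powr (real n / m) = cmod w ^ n"
        using m elim by (simp add: powr_powr powr_realpow)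
      then show ?case
        using fock_density_nonneg[OF m \<alpha>, of w]
        by (simp add: h_def fock_density_def C_def ennreal_mult'[symmetric] mult_ac)
    qed
  qed
  also have "\<dots> = (\<integral>\<^sup>+ t. h t \<partial>distr lborel borel (\<lambda>z::complex. cmod z powr m))"
    by (rule nn_integral_distr[symmetric]) measurable
  also have "\<dots> = (\<integral>\<^sup>+ t. ennreal (indicator {0..} t * (pi * (2/m) * t powr (2/m - 1))) * h t \<partial>lborel)"
    unfolding distr_lborel_cmod_powr[OF m] by (rule nn_integral_density) measurable
  also have "\<dots> = (\<integral>\<^sup>+ t. ennreal (C * pi * (2/m)) *
      ennreal (indicator {0..} t * (t powr ((real n + 2) / m - 1) * exp (- \<alpha> * t))) \<partial>lborel)"
  proof (rule nn_integral_cong)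
    fix t :: real
    have "(real n + 2) / m - 1 = (2 / m - 1) + real n / m" by (simp add: add_divide_distrib)
    then have "t powr ((real n + 2) / m - 1) = t powr (2/m - 1) * t powr (real n / m)"
      by (simp only: powr_add)
    then show "ennreal (indicator {0..} t * (pi * (2/m) * t powr (2/m - 1))) * h t = ennreal (C * pi * (2/m)) *
      ennreal (indicator {0..} t * (t powr ((real n + 2) / m - 1) * exp (- \<alpha> * t)))"
      using C m by (auto simp: h_def ennreal_mult'[symmetric] mult_ac indicator_def)
  qed
  also have "\<dots> = ennreal (C * pi * (2/m)) * ennreal (Gamma ((real n + 2) / m) / \<alpha> powr ((real n + 2) / m))"
    using m \<alpha> by (subst nn_integral_cmult, measurable, subst nn_integral_powr_exp) auto
  also have "\<dots> = ennreal (C * pi * (2/m) * (Gamma ((real n + 2) / m) / \<alpha> powr ((real n + 2) / m)))"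
    using C m by (intro ennreal_mult'[symmetric]) simp
  also have "C * pi * (2/m) = \<alpha> powr (2 / m) / Gamma (2 / m)"
    using m by (simp add: C_def)
  also have "\<alpha> powr ((real n + 2) / m) = \<alpha> powr (2 / m) * \<alpha> powr (real n / m)"
    by (simp add: add_divide_distrib add.commute flip: powr_add)
  also have "\<alpha> powr (2 / m) / Gamma (2 / m) * (Gamma ((real n + 2) / m) / (\<alpha> powr (2 / m) * \<alpha> powr (real n / m)))
    = Gamma ((real n + 2) / m) / (Gamma (2 / m) * \<alpha> powr (real n / m))"
    using \<alpha> by simp
  finally show ?thesis .
qed

lemma radial_measure_fock:
  assumes m: "m > 0" and \<alpha>: "\<alpha> > 0"
  shows "radial_measure (fock_borel \<alpha> m)"
proof
  show "sets (fock_borel \<alpha> m) = sets borel" by (rule sets_fock_borel)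
  show "distr (fock_borel \<alpha> m) borel ((*) u) = fock_borel \<alpha> m" if u: "cmod u = 1" for u
  proof -
    have "fock_borel \<alpha> m = density (distr lborel borel ((*) u)) (\<lambda>z. ennreal (fock_density \<alpha> m z))"
      unfolding fock_borel_def distr_lborel_complex_rotation[OF u] ..
    also have "\<dots> = distr (density lborel (\<lambda>z. ennreal (fock_density \<alpha> m (u * z)))) borel ((*) u)"
      by (rule density_distr) measurable
    also have "\<dots> = distr (fock_borel \<alpha> m) borel ((*) u)"
      by (simp add: fock_borel_def fock_density_def norm_mult u)
    finally show ?thesis ..
  qed
  show "integrable (fock_borel \<alpha> m) (\<lambda>w. cmod w ^ n)" for n
    by (rule integrableI_nn_integral_finite[OF _ _ nn_integral_fock_moment[OF m \<alpha>]])
       (use m \<alpha> in \<open>auto intro!: divide_nonneg_nonneg mult_nonneg_nonneg Gamma_real_nonneg\<close>)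
  \<comment> \<open>The density is positive, so a null exterior would make the plane agree almost
    everywhere with a disc of finite area.\<close>
  show "emeasure (fock_borel \<alpha> m) {w. R < cmod w} \<noteq> 0" for R
  proof
    assume "emeasure (fock_borel \<alpha> m) {w. R < cmod w} = 0"
    then have "(\<integral>\<^sup>+ w. ennreal (fock_density \<alpha> m w) * indicator {w. R < cmod w} w \<partial>lborel) = 0"
      unfolding fock_borel_def by (subst (asm) emeasure_density) auto
    then have "AE w in lborel. ennreal (fock_density \<alpha> m w) * indicator {w. R < cmod w} w = 0"
      by (subst (asm) nn_integral_0_iff_AE) auto
    then have "AE w in lborel. w \<in> UNIV \<longleftrightarrow> w \<in> cball (0::complex) R"
    proof eventually_elim
      case (elim w)
      then show ?case using fock_density_pos[OF m \<alpha>, of w]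
        by (auto simp: indicator_def ennreal_eq_0_iff split: if_splits)
    qed
    then have "emeasure lborel (UNIV :: complex set) = emeasure lborel (cball (0::complex) R)"
      by (intro emeasure_eq_AE) auto
    then show False using emeasure_lborel_cball_finite[of "0::complex" R] by simp
  qed
qed

text \<open>The reciprocal of the \<open>n\<close>-th moment for
  \<open>\<alpha> = 1\<close>.\<close>

definition fock_coeff :: "real \<Rightarrow> nat \<Rightarrow> real" where
  "fock_coeff m n = Gamma (2 / m) / Gamma ((2 * real n + 2) / m)"

text \<open>Up to the factor \<open>\<Gamma>(2/m)\<close> this is the Mittag-Leffler function with both indices equal
  to \<open>2/m\<close>.\<close>
definition fock_series :: "real \<Rightarrow> 'a :: {real_normed_field, banach} \<Rightarrow> 'a" where
  "fock_series m x = (\<Sum>n. of_real (fock_coeff m n) * x ^ n)"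

text \<open>The parameter enters only through a geometric factor, so the kernels for all
  \<open>\<alpha>\<close> are dilations of one series.\<close>

lemma moment_fock:
  assumes m: "m > 0" and \<alpha>: "\<alpha> > 0"
  shows "radial_measure.moment (fock_borel \<alpha> m) n = 1 / (fock_coeff m n * (\<alpha> powr (2 / m)) ^ n)"
proof -
  interpret radial_measure "fock_borel \<alpha> m" by (rule radial_measure_fock[OF m \<alpha>])
  have "ennreal (moment n) = ennreal (Gamma ((real (2 * n) + 2) / m) / (Gamma (2 / m) * \<alpha> powr (real (2 * n) / m)))"
    unfolding nn_integral_fock_moment[OF m \<alpha>, symmetric] moment_def
    by (intro nn_integral_eq_integral[symmetric] integrable_moment) auto
  moreover have "Gamma ((real (2 * n) + 2) / m) / (Gamma (2 / m) * \<alpha> powr (real (2 * n) / m)) \<ge> 0"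
    using m by (intro divide_nonneg_nonneg mult_nonneg_nonneg Gamma_real_nonneg) auto
  ultimately have "moment n = Gamma ((real (2 * n) + 2) / m) / (Gamma (2 / m) * \<alpha> powr (real (2 * n) / m))"
    using moment_pos[of n] by (simp add: ennreal_inj less_imp_le)
  also have "\<alpha> powr (real (2 * n) / m) = (\<alpha> powr (2 / m)) ^ n"
    using \<alpha> by (simp add: powr_realpow[symmetric] powr_powr mult.commute)
  finally show ?thesis by (simp add: fock_coeff_def)
qed

lemma fock_coeff_pos: "m > 0 \<Longrightarrow> fock_coeff m n > 0"
  unfolding fock_coeff_def by (intro divide_pos_pos Gamma_real_pos) auto

lemma fock_coeff_0 [simp]: "m > 0 \<Longrightarrow> fock_coeff m 0 = 1"
  using Gamma_real_pos[of "2 / m"] by (simp add: fock_coeff_def less_imp_neq[symmetric])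

lemma summable_norm_fock_series:
  fixes x :: "'a :: {real_normed_field, banach}"
  assumes m: "m > 0"
  shows "summable (\<lambda>n. norm (of_real (fock_coeff m n) * x ^ n))"
proof -
  interpret radial_measure "fock_borel 1 m" by (rule radial_measure_fock[OF m]) simp
  show ?thesis
    using summable_power_div_moment[of "norm x"] fock_coeff_pos[OF m]
    by (simp add: moment_fock[OF m] norm_mult norm_power mult.commute less_imp_le)
qed

lemma summable_fock_series:
  fixes x :: "'a :: {real_normed_field, banach}"
  assumes "m > 0"
  shows "summable (\<lambda>n. of_real (fock_coeff m n) * x ^ n)"
  by (rule summable_norm_cancel) (rule summable_norm_fock_series[OF assms])

lemma fock_series_0 [simp]: "m > 0 \<Longrightarrow> fock_series m 0 = 1"
  unfolding fock_series_def by (subst powser_zero) simp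

lemma fock_series_of_real:
  assumes "m > 0"
  shows "fock_series m (complex_of_real x) = of_real (fock_series m x)"
  using suminf_of_real[OF summable_fock_series[OF assms, of x], where 'a = complex]
  by (simp add: fock_series_def)

lemma continuous_fock_series:
  assumes "m > 0"
  shows "continuous_on UNIV (fock_series m :: 'a :: {real_normed_field, banach} \<Rightarrow> 'a)"
proof -
  have "isCont (\<lambda>x::'a. \<Sum>n. of_real (fock_coeff m n) * x ^ n) x" for x
    by (rule isCont_powser_converges_everywhere) (rule summable_fock_series[OF assms])
  then show ?thesis
    by (simp add: fock_series_def[abs_def] continuous_on_eq_continuous_at)
qed

lemma kern_fock:
  assumes m: "m > 0" and \<alpha>: "\<alpha> > 0"
  shows "radial_measure.kern (fock_borel \<alpha> m) w z = fock_series m (of_real (\<alpha> powr (2 / m)) * w * cnj z)"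
proof -
  interpret radial_measure "fock_borel \<alpha> m" by (rule radial_measure_fock[OF m \<alpha>])
  show ?thesis
    unfolding kern_def fock_series_def moment_fock[OF m \<alpha>]
    by (intro suminf_cong) (simp add: power_mult_distrib)
qed

text \<open>If \<open>L\<close> also reproduces, then \<open>L w z = \<langle>L(\<cdot>, z), K(\<cdot>, w)\<rangle>\<close> and
  \<open>K z w = \<langle>K(\<cdot>, w), L(\<cdot>, z)\<rangle>\<close> are conjugate to each other.\<close>
lemma fock_kernel_eq:
  assumes m: "m > 0" and \<alpha>: "\<alpha> > 0"
  shows "fock_kernel \<alpha> m w z = fock_series m (of_real (\<alpha> powr (2 / m)) * w * cnj z)"
proof -
  interpret radial_measure "fock_borel \<alpha> m" by (rule radial_measure_fock[OF m \<alpha>])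
  \<comment> \<open>Entire functions are Borel measurable, so membership can be tested with
    \<open>fock_borel\<close>, where the results of the locale apply.\<close>
  have space: "f \<in> fock_space \<alpha> m \<longleftrightarrow>
      f holomorphic_on UNIV \<and> integrable (fock_borel \<alpha> m) (\<lambda>z. (cmod (f z))\<^sup>2)" for f
  proof (cases "f holomorphic_on UNIV")
    case True
    then have [measurable]: "f \<in> borel_measurable borel"
      by (intro borel_measurable_continuous_onI holomorphic_on_imp_continuous_on)
    show ?thesis
      unfolding fock_space_def using integrable_fock_measure_borel[OF m \<alpha>, of "\<lambda>z. (cmod (f z))\<^sup>2"] by simp
  qed (simp add: fock_space_def)
  have meas: "f \<in> borel_measurable borel" if "f \<in> fock_space \<alpha> m" for f
    using that unfolding space
    by (auto intro!: borel_measurable_continuous_onI holomorphic_on_imp_continuous_on)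
  have inner: "fock_inner \<alpha> m f g = (\<integral>w. f w * cnj (g w) \<partial>fock_borel \<alpha> m)"
    if "f \<in> fock_space \<alpha> m" "g \<in> fock_space \<alpha> m" for f g
  proof -
    note [measurable] = meas[OF that(1)] meas[OF that(2)]
    show ?thesis
      unfolding fock_inner_def by (rule integral_fock_measure_borel[OF m \<alpha>]) measurable
  qed
  have K1: "(\<lambda>w. kern w z) \<in> fock_space \<alpha> m" for z
    unfolding space using kern_holomorphic integrable_kern_square by blast
  have K2: "f z = fock_inner \<alpha> m f (\<lambda>w. kern w z)" if "f \<in> fock_space \<alpha> m" for f z
    using kern_reproducing[of f z] that inner[OF that K1] unfolding space by simp
  have inner_sym: "fock_inner \<alpha> m f g = cnj (fock_inner \<alpha> m g f)" for f g
    unfolding fock_inner_def using Bochner_Integration.integral_cnj[of "fock_measure \<alpha> m" "\<lambda>w. g w * cnj (f w)"]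
    by (simp add: mult.commute)
  have "fock_kernel \<alpha> m = kern"
    unfolding fock_kernel_def
  proof (rule the_equality)
    show "(\<forall>z. (\<lambda>w. kern w z) \<in> fock_space \<alpha> m) \<and>
        (\<forall>f\<in>fock_space \<alpha> m. \<forall>z. f z = fock_inner \<alpha> m f (\<lambda>w. kern w z))"
      using K1 K2 by blast
    fix L assume L: "(\<forall>z. (\<lambda>w. L w z) \<in> fock_space \<alpha> m) \<and>
        (\<forall>f\<in>fock_space \<alpha> m. \<forall>z. f z = fock_inner \<alpha> m f (\<lambda>w. L w z))"
    show "L = kern"
    proof (intro ext)
      fix w z
      have "L w z = fock_inner \<alpha> m (\<lambda>v. L v z) (\<lambda>v. kern v w)"
        using K2[of "\<lambda>v. L v z" w] L by blast
      also have "\<dots> = cnj (fock_inner \<alpha> m (\<lambda>v. kern v w) (\<lambda>v. L v z))"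
        by (rule inner_sym)
      also have "fock_inner \<alpha> m (\<lambda>v. kern v w) (\<lambda>v. L v z) = kern z w"
        using L K1[of w] by (metis (no_types, lifting))
      finally show "L w z = kern w z" by (simp add: cnj_kern)
    qed
  qed
  then show ?thesis by (simp add: kern_fock[OF m \<alpha>])
qed

section \<open>Berezin transforms of radial exponentials\<close>

lemma fock_kernel_diag:
  assumes m: "m > 0" and \<alpha>: "\<alpha> > 0"
  shows "fock_kernel \<alpha> m z z = of_real (fock_series m (\<alpha> powr (2 / m) * (cmod z)\<^sup>2))"
proof -
  have "of_real (\<alpha> powr (2 / m)) * z * cnj z = complex_of_real (\<alpha> powr (2 / m) * (cmod z)\<^sup>2)"
    using complex_norm_square[of z] by simp
  then show ?thesis
    using fock_kernel_eq[OF m \<alpha>, of z z] fock_series_of_real[OF m] by metis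
qed

lemma berezin_eq:
  assumes m: "m > 0" and \<alpha>: "\<alpha> > 0"
  shows "berezin \<alpha> m f z = (LINT w|fock_measure \<alpha> m.
    f w * of_real ((cmod (fock_series m (of_real (\<alpha> powr (2 / m)) * w * cnj z)))\<^sup>2
      / fock_series m (\<alpha> powr (2 / m) * (cmod z)\<^sup>2)))"
  unfolding berezin_def fock_kernel_diag[OF m \<alpha>] fock_kernel_eq[OF m \<alpha>] by simp

text \<open>The kernel with second argument 0 is the constant 1, since
  \<open>fock_series m 0 = 1\<close>.\<close>

lemma berezin_at_0:
  assumes "m > 0" "\<alpha> > 0"
  shows "berezin \<alpha> m f 0 = integral\<^sup>L (fock_measure \<alpha> m) f"
  unfolding berezin_eq[OF assms] using assms by simp

lemma fock_density_mult_exp: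
  assumes "m > 0" "\<beta> > 0" "\<delta> > 0"
  shows "fock_density \<beta> m w * exp (- \<delta> * cmod w powr m)
    = (\<beta> / (\<beta> + \<delta>)) powr (2 / m) * fock_density (\<beta> + \<delta>) m w"
proof -
  have "exp (- \<beta> * cmod w powr m) * exp (- \<delta> * cmod w powr m) = exp (- (\<beta> + \<delta>) * cmod w powr m)"
    by (simp add: exp_add[symmetric] algebra_simps)
  moreover have "\<beta> powr (2 / m) = (\<beta> / (\<beta> + \<delta>)) powr (2 / m) * (\<beta> + \<delta>) powr (2 / m)"
    using assms by (simp flip: powr_mult)
  ultimately show ?thesis by (simp add: fock_density_def)
qed

text \<open>Multiplying by the exponential shifts the parameter of the measure to
  \<open>\<beta> + \<delta>\<close>. The kernel for \<open>\<beta>\<close> at \<open>z\<close> is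
  the kernel for \<open>\<beta> + \<delta>\<close> at a dilated point \<open>z'\<close>, so the
  integral is a squared norm and reproduction evaluates it as the diagonal value at
  \<open>z'\<close>.\<close>

lemma berezin_exp:
  assumes m: "m > 0" and \<beta>: "\<beta> > 0" and \<delta>: "\<delta> > 0"
  shows "berezin \<beta> m (\<lambda>w. of_real (exp (- \<delta> * cmod w powr m))) z
    = of_real ((\<beta> / (\<beta> + \<delta>)) powr (2 / m) * fock_series m ((\<beta>\<^sup>2 / (\<beta> + \<delta>)) powr (2 / m) * (cmod z)\<^sup>2)
        / fock_series m (\<beta> powr (2 / m) * (cmod z)\<^sup>2))"
proof -
  define s where "s = 2 / m"
  define q where "q = fock_series m (\<beta> powr s * (cmod z)\<^sup>2)"
  \<comment> \<open>\<open>t\<close> plays two parts: it is the ratio of the normalizing constants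
    for \<open>\<beta>\<close> and \<open>\<beta> + \<delta>\<close>, and it is the dilation factor
    that matches the two kernels.\<close>
  define t where "t = (\<beta> / (\<beta> + \<delta>)) powr s"
  define z' where "z' = of_real t * z"
  have \<beta>\<delta>: "\<beta> + \<delta> > 0" using \<beta> \<delta> by simp
  interpret R: radial_measure "fock_borel (\<beta> + \<delta>) m" by (rule radial_measure_fock[OF m \<beta>\<delta>])
  have t: "(\<beta> + \<delta>) powr s * t = \<beta> powr s"
    using \<beta> \<delta> by (simp add: t_def flip: powr_mult)
  have t2: "(\<beta> + \<delta>) powr s * t\<^sup>2 = (\<beta>\<^sup>2 / (\<beta> + \<delta>)) powr s"
    using \<beta> \<delta> by (simp add: power2_eq_square mult.assoc[symmetric] t) (simp add: t_def flip: powr_mult)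
  have kern: "fock_series m (of_real (\<beta> powr s) * w * cnj z) = R.kern w z'" for w
    unfolding kern_fock[OF m \<beta>\<delta>] s_def[symmetric] t[symmetric] z'_def by (simp add: mult_ac)
  note [measurable] = R.borel_measurable_kern[of z']
  have "berezin \<beta> m (\<lambda>w. of_real (exp (- \<delta> * cmod w powr m))) z
    = (LINT w|fock_measure \<beta> m. of_real (exp (- \<delta> * cmod w powr m)) * of_real ((cmod (R.kern w z'))\<^sup>2 / q))"
    unfolding berezin_eq[OF m \<beta>] kern[symmetric] q_def s_def ..
  also have "\<dots> = (LINT w|fock_borel \<beta> m. of_real (exp (- \<delta> * cmod w powr m)) * of_real ((cmod (R.kern w z'))\<^sup>2 / q))"
    by (rule integral_fock_measure_borel[OF m \<beta>]) measurable
  also have "\<dots> = (LINT w|lborel. fock_density \<beta> m w *\<^sub>R (of_real (exp (- \<delta> * cmod w powr m)) * of_real ((cmod (R.kern w z'))\<^sup>2 / q)))"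
    by (rule integral_fock_borel[OF m \<beta>]) measurable
  also have "\<dots> = (LINT w|lborel. fock_density (\<beta> + \<delta>) m w *\<^sub>R (of_real (t / q) * (R.kern w z' * cnj (R.kern w z'))))"
  proof (rule Bochner_Integration.integral_cong[OF refl])
    fix w
    have "fock_density \<beta> m w *\<^sub>R (of_real (exp (- \<delta> * cmod w powr m)) * of_real ((cmod (R.kern w z'))\<^sup>2 / q))
      = complex_of_real ((fock_density \<beta> m w * exp (- \<delta> * cmod w powr m)) * ((cmod (R.kern w z'))\<^sup>2 / q))"
      by (simp add: scaleR_conv_of_real)
    also have "\<dots> = complex_of_real (fock_density (\<beta> + \<delta>) m w * (t / q * (cmod (R.kern w z'))\<^sup>2))"
      unfolding fock_density_mult_exp[OF m \<beta> \<delta>] t_def s_def by (simp add: mult_ac)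
    also have "\<dots> = fock_density (\<beta> + \<delta>) m w *\<^sub>R (of_real (t / q) * (R.kern w z' * cnj (R.kern w z')))"
      unfolding complex_norm_square[symmetric] by (simp add: scaleR_conv_of_real)
    finally show "fock_density \<beta> m w *\<^sub>R (of_real (exp (- \<delta> * cmod w powr m)) * of_real ((cmod (R.kern w z'))\<^sup>2 / q))
      = fock_density (\<beta> + \<delta>) m w *\<^sub>R (of_real (t / q) * (R.kern w z' * cnj (R.kern w z')))" .
  qed
  also have "\<dots> = (LINT w|fock_borel (\<beta> + \<delta>) m. of_real (t / q) * (R.kern w z' * cnj (R.kern w z')))"
    by (rule integral_fock_borel[OF m \<beta>\<delta>, symmetric]) measurable
  also have "\<dots> = of_real (t / q) * (LINT w|fock_borel (\<beta> + \<delta>) m. R.kern w z' * cnj (R.kern w z'))"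
    by (rule integral_mult_right_zero)
  also have "(LINT w|fock_borel (\<beta> + \<delta>) m. R.kern w z' * cnj (R.kern w z')) = R.kern z' z'"
    by (rule R.kern_reproducing[OF R.kern_holomorphic R.integrable_kern_square])
  also have "R.kern z' z' = of_real (fock_series m ((\<beta>\<^sup>2 / (\<beta> + \<delta>)) powr s * (cmod z)\<^sup>2))"
  proof -
    have "of_real ((\<beta> + \<delta>) powr s) * z' * cnj z' = complex_of_real (((\<beta> + \<delta>) powr s * t\<^sup>2) * (cmod z)\<^sup>2)"
      unfolding z'_def using complex_norm_square[of z] by (simp add: power2_eq_square mult_ac)
    then show ?thesis
      unfolding kern_fock[OF m \<beta>\<delta>] s_def[symmetric] t2
      by (simp only: fock_series_of_real[OF m])
  qed
  finally show ?thesis by (simp add: t_def q_def s_def)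
qed

section \<open>Estimates for the kernel series on the nonnegative half-line\<close>

lemma fock_series_expansion:
  fixes x :: real
  assumes "m > 0"
  shows "(\<lambda>n. fock_coeff m n * x ^ n) sums fock_series m x"
  using summable_sums[OF summable_fock_series[OF assms, of x]] by (simp add: fock_series_def)

text \<open>Positive coefficients: the first two terms bound the sum from below.\<close>

lemma fock_series_ge_linear:
  fixes x :: real
  assumes m: "m > 0" and x: "x \<ge> 0"
  shows "1 + fock_coeff m 1 * x \<le> fock_series m x"
proof -
  have "(\<Sum>n<2. fock_coeff m n * x ^ n) \<le> fock_series m x"
    unfolding sums_unique[OF fock_series_expansion[OF m, of x]]
    by (rule sum_le_suminf) (use fock_series_expansion[OF m, of x] fock_coeff_pos[OF m] x in
        \<open>auto simp: sums_iff less_imp_le\<close>)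
  then show ?thesis using m by (simp add: numeral_2_eq_2)
qed

lemma fock_series_ge_1:
  fixes x :: real
  assumes m: "m > 0" and x: "x \<ge> 0"
  shows "1 \<le> fock_series m x"
  using fock_series_ge_linear[OF assms] mult_nonneg_nonneg[OF less_imp_le[OF fock_coeff_pos[OF m, of 1]] x]
  by simp

text \<open>Without the constant term every power is at least the first, and
  \<open>t ^ Suc n \<le> t\<close>. This is the upper counterpart of
  \<open>fock_series_ge_linear\<close>.\<close>

lemma fock_series_contract:
  fixes x :: real
  assumes m: "m > 0" and x: "x \<ge> 0" and t: "0 \<le> t" "t \<le> 1"
  shows "fock_series m (t * x) - 1 \<le> t * (fock_series m x - 1)"
proof (rule sums_le)
  have tail: "(\<lambda>n. fock_coeff m (Suc n) * y ^ Suc n) sums (fock_series m y - 1)" for y :: real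
    using fock_series_expansion[OF m, of y] m
    by (subst sums_Suc_iff) simp
  show "(\<lambda>n. fock_coeff m (Suc n) * (t * x) ^ Suc n) sums (fock_series m (t * x) - 1)"
    by (rule tail)
  show "(\<lambda>n. t * (fock_coeff m (Suc n) * x ^ Suc n)) sums (t * (fock_series m x - 1))"
    by (intro sums_mult tail)
  fix n
  have "t ^ Suc n \<le> t" using t by (simp add: mult_left_le power_le_one)
  then have "t ^ Suc n * (fock_coeff m (Suc n) * x ^ Suc n) \<le> t * (fock_coeff m (Suc n) * x ^ Suc n)"
    using x less_imp_le[OF fock_coeff_pos[OF m, of "Suc n"]] by (intro mult_right_mono mult_nonneg_nonneg) auto
  then show "fock_coeff m (Suc n) * (t * x) ^ Suc n \<le> t * (fock_coeff m (Suc n) * x ^ Suc n)"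
    by (simp add: power_mult_distrib mult_ac)
qed

text \<open>Contraction with the factor \<open>x / y\<close>.\<close>

lemma fock_series_mono:
  fixes x y :: real
  assumes m: "m > 0" and xy: "0 \<le> x" "x \<le> y"
  shows "fock_series m x \<le> fock_series m y"
proof (cases "y = 0")
  case False
  then have y: "y > 0" using xy by simp
  have "fock_series m (x / y * y) - 1 \<le> x / y * (fock_series m y - 1)"
    using xy y by (intro fock_series_contract[OF m]) auto
  also have "\<dots> \<le> 1 * (fock_series m y - 1)"
    using xy y fock_series_ge_1[OF m, of y] by (intro mult_right_mono) auto
  finally show ?thesis using y by simp
qed (use xy in simp)

lemma borel_measurable_fock_series [measurable (raw)]:
  fixes f :: "'b \<Rightarrow> real"
  assumes "m > 0" "f \<in> borel_measurable N"
  shows "(\<lambda>x. fock_series m (f x)) \<in> borel_measurable N"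
  by (rule measurable_compose[OF assms(2)])
     (rule borel_measurable_continuous_onI[OF continuous_fock_series[OF assms(1)]])

lemma berezin_berezin_exp_at_0:
  assumes m: "m > 0" and \<alpha>: "\<alpha> > 0" and \<beta>: "\<beta> > 0" and \<delta>: "\<delta> > 0"
  shows "berezin \<alpha> m (berezin \<beta> m (\<lambda>w. of_real (exp (- \<delta> * cmod w powr m)))) 0
    = of_real ((\<beta> / (\<beta> + \<delta>)) powr (2 / m) *
        (LINT w|fock_borel \<alpha> m. fock_series m ((\<beta>\<^sup>2 / (\<beta> + \<delta>)) powr (2 / m) * (cmod w)\<^sup>2)
          / fock_series m (\<beta> powr (2 / m) * (cmod w)\<^sup>2)))"
proof -
  note [measurable] = borel_measurable_fock_series[OF m]
  let ?h = "\<lambda>w. fock_series m ((\<beta>\<^sup>2 / (\<beta> + \<delta>)) powr (2 / m) * (cmod w)\<^sup>2)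
          / fock_series m (\<beta> powr (2 / m) * (cmod w)\<^sup>2)"
  have "berezin \<alpha> m (berezin \<beta> m (\<lambda>w. of_real (exp (- \<delta> * cmod w powr m)))) 0
    = (LINT w|fock_measure \<alpha> m. complex_of_real ((\<beta> / (\<beta> + \<delta>)) powr (2 / m) * ?h w))"
    unfolding berezin_at_0[OF m \<alpha>] berezin_exp[OF m \<beta> \<delta>] by simp
  also have "\<dots> = (LINT w|fock_borel \<alpha> m. complex_of_real ((\<beta> / (\<beta> + \<delta>)) powr (2 / m) * ?h w))"
    by (rule integral_fock_measure_borel[OF m \<alpha>]) measurable
  also have "\<dots> = of_real (LINT w|fock_borel \<alpha> m. (\<beta> / (\<beta> + \<delta>)) powr (2 / m) * ?h w)"
    by (rule integral_complex_of_real)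
  also have "(LINT w|fock_borel \<alpha> m. (\<beta> / (\<beta> + \<delta>)) powr (2 / m) * ?h w)
    = (\<beta> / (\<beta> + \<delta>)) powr (2 / m) * (LINT w|fock_borel \<alpha> m. ?h w)"
    by (rule integral_mult_right_zero)
  finally show ?thesis .
qed

section \<open>Commutation at the origin\<close>

lemma
  assumes m: "m > 0" and \<alpha>: "\<alpha> > 0"
  shows finite_measure_fock_borel: "finite_measure (fock_borel \<alpha> m)"
    and integral_fock_borel_const: "(LINT w|fock_borel \<alpha> m. 1) = (1::real)"
proof -
  interpret radial_measure "fock_borel \<alpha> m" by (rule radial_measure_fock[OF m \<alpha>])
  show "finite_measure (fock_borel \<alpha> m)" by (rule finite_measure_M)
  have "moment 0 = 1" using m by (simp add: moment_fock[OF m \<alpha>])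
  then show "(LINT w|fock_borel \<alpha> m. 1) = (1::real)" by (simp add: moment_def)
qed

text \<open>The integrand of \<open>berezin_berezin_exp_at_0\<close> for \<open>\<beta> = 1\<close>,
  with \<open>c\<close> standing for \<open>1 / (1 + \<delta>)\<close>.\<close>

definition fock_ratio :: "real \<Rightarrow> real \<Rightarrow> complex \<Rightarrow> real" where
  "fock_ratio m c w = fock_series m (c powr (2 / m) * (cmod w)\<^sup>2) / fock_series m ((cmod w)\<^sup>2)"

lemma borel_measurable_fock_ratio [measurable]:
  assumes "m > 0"
  shows "fock_ratio m c \<in> borel_measurable borel"
proof -
  note [measurable] = borel_measurable_fock_series[OF assms]
  show ?thesis unfolding fock_ratio_def[abs_def] by measurable
qed

lemma fock_ratio_bounds:
  assumes m: "m > 0" and c: "0 \<le> c" "c \<le> 1"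
  shows "0 \<le> fock_ratio m c w" "fock_ratio m c w \<le> 1"
proof -
  have "c powr (2 / m) \<le> 1" using m c by (intro powr_le1) auto
  then have "c powr (2 / m) * (cmod w)\<^sup>2 \<le> (cmod w)\<^sup>2" by (intro mult_left_le_one_le) auto
  then have "fock_series m (c powr (2 / m) * (cmod w)\<^sup>2) \<le> fock_series m ((cmod w)\<^sup>2)"
    by (intro fock_series_mono[OF m]) auto
  moreover have "1 \<le> fock_series m (c powr (2 / m) * (cmod w)\<^sup>2)" "1 \<le> fock_series m ((cmod w)\<^sup>2)"
    by (intro fock_series_ge_1[OF m]; simp)+
  ultimately show "0 \<le> fock_ratio m c w" "fock_ratio m c w \<le> 1"
    by (auto simp: fock_ratio_def)
qed

text \<open>Dividing the commutation identity for the parameters \<open>\<alpha>\<close> and \<open>1\<close> by \<open>\<alpha> powr (2/m)\<close> and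
  letting \<open>\<alpha>\<close> tend to 0.\<close>
lemma integral_fock_ratio:
  fixes m c :: real
  assumes m: "m > 0" and c: "0 < c" "c < 1"
    and comm: "\<And>\<alpha> \<delta>. \<alpha> > 0 \<Longrightarrow> \<delta> > 0 \<Longrightarrow>
      berezin \<alpha> m (berezin 1 m (\<lambda>w. of_real (exp (- \<delta> * cmod w powr m)))) 0 =
      berezin 1 m (berezin \<alpha> m (\<lambda>w. of_real (exp (- \<delta> * cmod w powr m)))) 0"
  shows "integrable lborel (fock_ratio m c)"
    and "(LINT w|lborel. fock_ratio m c w) = 2 * pi * Gamma (2 / m) / m * (1 - c) powr (- (2 / m))"
proof -
  define s where "s = 2 / m"
  define \<delta> where "\<delta> = (1 - c) / c"
  define \<kappa> where "\<kappa> = m / (2 * pi * Gamma s)"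
  have s: "s > 0" using m by (simp add: s_def)
  have \<delta>: "\<delta> > 0" using c by (simp add: \<delta>_def)
  have c\<delta>: "1 / (1 + \<delta>) = c" using c by (simp add: \<delta>_def field_simps)
  have \<kappa>: "\<kappa> > 0" unfolding \<kappa>_def using m s by (intro divide_pos_pos mult_pos_pos Gamma_real_pos) auto
  \<comment> \<open>Decreasing to 0, so that \<open>F\<close> increases to \<open>fock_ratio\<close>
    and monotone convergence yields integrability of the limit together with its integral.\<close>
  define \<alpha> where "\<alpha> i = 1 / real (Suc i)" for i
  have \<alpha>: "\<alpha> i > 0" for i by (simp add: \<alpha>_def)
  have \<alpha>_lim: "\<alpha> \<longlonglongrightarrow> 0" unfolding \<alpha>_def by (rule LIMSEQ_Suc) (rule lim_1_over_n)
  have \<alpha>_mono: "\<alpha> j \<le> \<alpha> i" if "i \<le> j" for i j using that by (simp add: \<alpha>_def field_simps)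
  note [measurable] = borel_measurable_fock_ratio[OF m] borel_measurable_fock_series[OF m]
  \<comment> \<open>\<open>F\<close> is the left integrand with the constant
    \<open>\<kappa> * \<alpha> i powr s\<close> of the density removed; \<open>r\<close> is the
    integrand when the two transforms are exchanged.\<close>
  define F where "F i w = exp (- \<alpha> i * cmod w powr m) * fock_ratio m c w" for i w
  define r where "r i w = fock_series m (((\<alpha> i)\<^sup>2 / (\<alpha> i + \<delta>)) powr s * (cmod w)\<^sup>2)
          / fock_series m ((\<alpha> i) powr s * (cmod w)\<^sup>2)" for i w
  have r_meas [measurable]: "r i \<in> borel_measurable borel" for i
    unfolding r_def[abs_def] by measurable
  have dens: "fock_density (\<alpha> i) m w = \<kappa> * \<alpha> i powr s * exp (- \<alpha> i * cmod w powr m)" for i w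
    by (simp add: fock_density_def \<kappa>_def s_def)
  have F_int: "integrable lborel (F i)" for i
  proof -
    interpret finite_measure "fock_borel (\<alpha> i) m" by (rule finite_measure_fock_borel[OF m \<alpha>])
    have "integrable (fock_borel (\<alpha> i) m) (fock_ratio m c)"
      using fock_ratio_bounds[OF m, of c] c
      by (intro integrable_const_bound[where B = 1]) auto
    then have "integrable lborel (\<lambda>w. \<kappa> * \<alpha> i powr s * F i w)"
      by (simp add: integrable_fock_borel[OF m \<alpha>] dens F_def mult.assoc)
    then have "integrable lborel (\<lambda>w. 1 / (\<kappa> * \<alpha> i powr s) * (\<kappa> * \<alpha> i powr s * F i w))"
      by (rule integrable_mult_right)
    then show ?thesis using \<kappa> \<alpha>[of i] by simp
  qed
  \<comment> \<open>The power \<open>\<alpha> i powr s\<close> occurs on both sides of the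
    commutation identity, once from the density and once from the prefactor of the inner transform,
    and cancels.\<close>
  have eq: "(LINT w|lborel. F i w) = 1 / \<kappa> * ((1 + \<delta>) / (\<alpha> i + \<delta>)) powr s * (LINT w|fock_borel 1 m. r i w)" for i
  proof -
    have ratio: "fock_series m ((1\<^sup>2 / (1 + \<delta>)) powr (2 / m) * (cmod w)\<^sup>2) / fock_series m (1 powr (2 / m) * (cmod w)\<^sup>2)
      = fock_ratio m c w" for w
      by (simp add: fock_ratio_def c\<delta>)
    have "complex_of_real ((1 / (1 + \<delta>)) powr s * (LINT w|fock_borel (\<alpha> i) m. fock_ratio m c w))
      = complex_of_real ((\<alpha> i / (\<alpha> i + \<delta>)) powr s * (LINT w|fock_borel 1 m. r i w))"
      using comm[OF \<alpha>[of i] \<delta>]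
      unfolding berezin_berezin_exp_at_0[OF m \<alpha>[of i] zero_less_one \<delta>]
        berezin_berezin_exp_at_0[OF m zero_less_one \<alpha>[of i] \<delta>] ratio r_def s_def .
    then have e1: "(1 / (1 + \<delta>)) powr s * (LINT w|fock_borel (\<alpha> i) m. fock_ratio m c w)
      = (\<alpha> i / (\<alpha> i + \<delta>)) powr s * (LINT w|fock_borel 1 m. r i w)"
      by (simp only: of_real_eq_iff)
    have "(LINT w|fock_borel (\<alpha> i) m. fock_ratio m c w) = (LINT w|lborel. \<kappa> * \<alpha> i powr s * F i w)"
      by (simp add: integral_fock_borel[OF m \<alpha>] dens F_def mult.assoc)
    also have "\<dots> = \<kappa> * \<alpha> i powr s * (LINT w|lborel. F i w)"
      by (rule integral_mult_right_zero)
    finally have e2: "(LINT w|fock_borel (\<alpha> i) m. fock_ratio m c w) = \<kappa> * \<alpha> i powr s * (LINT w|lborel. F i w)" .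
    have p1: "(1 / (1 + \<delta>)) powr s = 1 / (1 + \<delta>) powr s"
      using \<delta> by (subst powr_divide) auto
    have p2: "(\<alpha> i / (\<alpha> i + \<delta>)) powr s = \<alpha> i powr s / (\<alpha> i + \<delta>) powr s"
      using \<delta> \<alpha>[of i] by (subst powr_divide) auto
    have p3: "((1 + \<delta>) / (\<alpha> i + \<delta>)) powr s = (1 + \<delta>) powr s / (\<alpha> i + \<delta>) powr s"
      using \<delta> \<alpha>[of i] by (subst powr_divide) auto
    have "\<alpha> i powr s > 0" "(1 + \<delta>) powr s > 0" "(\<alpha> i + \<delta>) powr s > 0"
      using \<alpha>[of i] \<delta> by auto
    then show ?thesis
      using e1 \<kappa> unfolding e2 p1 p2 p3 by (simp add: field_simps)
  qed
  \<comment> \<open>Both arguments of the series in \<open>r\<close> tend to 0, so the quotient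
    tends to 1; monotonicity of the series keeps it below 1.\<close>
  have r_lim: "(\<lambda>i. LINT w|fock_borel 1 m. r i w) \<longlonglongrightarrow> (LINT w|fock_borel 1 m. 1)"
  proof (rule integral_dominated_convergence[where w = "\<lambda>_. 1"])
    interpret finite_measure "fock_borel 1 m" by (rule finite_measure_fock_borel[OF m zero_less_one])
    show "integrable (fock_borel 1 m) (\<lambda>_. 1::real)" by simp
    show "AE w in fock_borel 1 m. (\<lambda>i. r i w) \<longlonglongrightarrow> 1"
    proof (rule AE_I2)
      fix w
      have cont: "isCont (fock_series m :: real \<Rightarrow> real) 0"
        using continuous_fock_series[OF m, where 'a = real] by (simp add: continuous_on_eq_continuous_at)
      have "(\<lambda>i. (\<alpha> i)\<^sup>2 / (\<alpha> i + \<delta>)) \<longlonglongrightarrow> 0\<^sup>2 / (0 + \<delta>)"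
        using \<delta> by (intro tendsto_intros \<alpha>_lim) auto
      then have "(\<lambda>i. ((\<alpha> i)\<^sup>2 / (\<alpha> i + \<delta>)) powr s) \<longlonglongrightarrow> 0"
        using s \<alpha> \<delta> by (intro tendsto_zero_powrI[where b = s]) (auto intro!: always_eventually divide_nonneg_pos add_pos_pos)
      then have "(\<lambda>i. ((\<alpha> i)\<^sup>2 / (\<alpha> i + \<delta>)) powr s * (cmod w)\<^sup>2) \<longlonglongrightarrow> 0 * (cmod w)\<^sup>2"
        by (intro tendsto_intros)
      then have l1: "(\<lambda>i. fock_series m (((\<alpha> i)\<^sup>2 / (\<alpha> i + \<delta>)) powr s * (cmod w)\<^sup>2)) \<longlonglongrightarrow> fock_series m 0"
        using isCont_tendsto_compose[OF cont] by simp
      have "(\<lambda>i. (\<alpha> i) powr s) \<longlonglongrightarrow> 0"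
        using s \<alpha> \<alpha>_lim by (intro tendsto_zero_powrI[where b = s]) (auto intro!: always_eventually less_imp_le)
      then have "(\<lambda>i. (\<alpha> i) powr s * (cmod w)\<^sup>2) \<longlonglongrightarrow> 0 * (cmod w)\<^sup>2"
        by (intro tendsto_intros)
      then have l2: "(\<lambda>i. fock_series m ((\<alpha> i) powr s * (cmod w)\<^sup>2)) \<longlonglongrightarrow> fock_series m 0"
        using isCont_tendsto_compose[OF cont] by simp
      show "(\<lambda>i. r i w) \<longlonglongrightarrow> 1"
        unfolding r_def using tendsto_divide[OF l1 l2] m by simp
    qed
    show "AE w in fock_borel 1 m. norm (r i w) \<le> 1" for i
    proof (rule AE_I2)
      fix w
      have "(\<alpha> i)\<^sup>2 / (\<alpha> i + \<delta>) \<le> \<alpha> i"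
        using \<alpha>[of i] \<delta> by (simp add: field_simps power2_eq_square)
      then have "((\<alpha> i)\<^sup>2 / (\<alpha> i + \<delta>)) powr s \<le> \<alpha> i powr s"
        using s \<alpha>[of i] \<delta> by (intro powr_mono2) auto
      then have "((\<alpha> i)\<^sup>2 / (\<alpha> i + \<delta>)) powr s * (cmod w)\<^sup>2 \<le> \<alpha> i powr s * (cmod w)\<^sup>2"
        by (intro mult_right_mono) auto
      then have "fock_series m (((\<alpha> i)\<^sup>2 / (\<alpha> i + \<delta>)) powr s * (cmod w)\<^sup>2) \<le> fock_series m (\<alpha> i powr s * (cmod w)\<^sup>2)"
        by (intro fock_series_mono[OF m]) auto
      moreover have "1 \<le> fock_series m (((\<alpha> i)\<^sup>2 / (\<alpha> i + \<delta>)) powr s * (cmod w)\<^sup>2)"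
        by (intro fock_series_ge_1[OF m]) auto
      ultimately show "norm (r i w) \<le> 1" by (simp add: r_def)
    qed
  qed measurable
  have "(\<lambda>i. 1 / \<kappa> * ((1 + \<delta>) / (\<alpha> i + \<delta>)) powr s * (LINT w|fock_borel 1 m. r i w))
      \<longlonglongrightarrow> 1 / \<kappa> * ((1 + \<delta>) / (0 + \<delta>)) powr s * 1"
    using \<delta> r_lim unfolding integral_fock_borel_const[OF m zero_less_one]
    by (intro tendsto_intros \<alpha>_lim) auto
  then have lim: "(\<lambda>i. LINT w|lborel. F i w) \<longlonglongrightarrow> 1 / \<kappa> * ((1 + \<delta>) / \<delta>) powr s"
    by (simp add: eq)
  have F_mono: "AE w in lborel. mono (\<lambda>i. F i w)"
  proof (intro AE_I2 monoI)
    fix w i j assume "i \<le> (j::nat)"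
    then show "F i w \<le> F j w"
      unfolding F_def using \<alpha>_mono[of i j] fock_ratio_bounds[OF m, of c w] c
      by (intro mult_right_mono) (auto intro: mult_right_mono)
  qed
  have F_lim: "AE w in lborel. (\<lambda>i. F i w) \<longlonglongrightarrow> fock_ratio m c w"
  proof (rule AE_I2)
    fix w
    have "(\<lambda>i. F i w) \<longlonglongrightarrow> exp (- 0 * cmod w powr m) * fock_ratio m c w"
      unfolding F_def by (intro tendsto_intros \<alpha>_lim)
    then show "(\<lambda>i. F i w) \<longlonglongrightarrow> fock_ratio m c w" by simp
  qed
  show "integrable lborel (fock_ratio m c)"
    by (rule integrable_monotone_convergence[OF F_int F_mono F_lim lim]) measurable
  have "(LINT w|lborel. fock_ratio m c w) = 1 / \<kappa> * ((1 + \<delta>) / \<delta>) powr s"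
    by (rule integral_monotone_convergence[OF F_int F_mono F_lim lim]) measurable
  also have "(1 + \<delta>) / \<delta> = inverse (1 - c)"
    using c by (simp add: \<delta>_def field_simps)
  also have "inverse (1 - c) powr s = (1 - c) powr (- s)"
    using c by (simp add: powr_minus inverse_powr)
  finally show "(LINT w|lborel. fock_ratio m c w) = 2 * pi * Gamma (2 / m) / m * (1 - c) powr (- (2 / m))"
    using c by (simp add: \<kappa>_def s_def)
qed

text \<open>Letting \<open>c\<close> tend to 0 forces \<open>a0 = 1\<close>. Then
  \<open>((1 - c) powr (- s) - 1) / c powr s\<close> lies between \<open>a1 > 0\<close> and
  \<open>B\<close>, but it behaves like \<open>s * c powr (1 - s)\<close>, which tends to 0 for
  \<open>s < 1\<close> and to infinity for \<open>s > 1\<close>.\<close>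

lemma powr_two_sided_bound_imp_1:
  fixes s :: real
  assumes s: "s > 0" and a1: "a1 > 0"
    and lower: "\<And>c. 0 < c \<Longrightarrow> c \<le> 1/2 \<Longrightarrow> a0 + a1 * c powr s \<le> (1 - c) powr (- s)"
    and upper: "\<And>c. 0 < c \<Longrightarrow> c \<le> 1/2 \<Longrightarrow> (1 - c) powr (- s) \<le> a0 + B * c powr s"
  shows "s = 1"
proof -
  have ev: "eventually (\<lambda>c. 0 < c \<and> c \<le> (1/2 :: real)) (at_right 0)"
    by (rule eventually_at_rightI[of 0 "1/2"]) auto
  have l0: "((\<lambda>c. (1 - c) powr (- s)) \<longlongrightarrow> 1) (at_right 0)"
    by real_asymp
  have lp: "((\<lambda>c. a0 + b * c powr s) \<longlongrightarrow> a0) (at_right 0)" for b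
    using s by real_asymp
  have "a0 \<le> 1"
    by (rule tendsto_le[OF _ l0 lp[of a1]]) (use ev lower in \<open>auto elim: eventually_mono\<close>)
  moreover have "1 \<le> a0"
    by (rule tendsto_le[OF _ lp[of B] l0]) (use ev upper in \<open>auto elim: eventually_mono\<close>)
  ultimately have a0: "a0 = 1" by simp
  define g where "g c = ((1 - c) powr (- s) - 1) / c powr s" for c
  have g1: "eventually (\<lambda>c. a1 \<le> g c) (at_right 0)"
    using ev
  proof eventually_elim
    case (elim c)
    then show ?case using lower[of c] by (simp add: g_def a0 field_simps)
  qed
  have g2: "eventually (\<lambda>c. g c \<le> B) (at_right 0)"
    using ev
  proof eventually_elim
    case (elim c)
    then show ?case using upper[of c] by (simp add: g_def a0 field_simps)
  qed
  have D: "((\<lambda>c. ((1 - c) powr (- s) - 1) / c) \<longlongrightarrow> s) (at_right 0)"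
    using s by real_asymp
  have g_eq: "eventually (\<lambda>c. ((1 - c) powr (- s) - 1) / c * c powr (1 - s) = g c) (at_right 0)"
    using ev
  proof eventually_elim
    case (elim c)
    then show ?case by (simp add: g_def powr_diff)
  qed
  consider "s < 1" | "s = 1" | "s > 1" by linarith
  then show ?thesis
  proof cases
    case 1
    have "((\<lambda>c. c powr (1 - s)) \<longlongrightarrow> 0) (at_right 0)" using 1 by real_asymp
    then have "((\<lambda>c. ((1 - c) powr (- s) - 1) / c * c powr (1 - s)) \<longlongrightarrow> s * 0) (at_right 0)"
      by (intro tendsto_mult D)
    then have "(g \<longlongrightarrow> 0) (at_right 0)"
      using tendsto_cong[OF g_eq] by simp
    then have "eventually (\<lambda>c. g c < a1) (at_right 0)" using a1 by (rule order_tendstoD)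
    then have "eventually (\<lambda>c. False) (at_right (0::real))"
      using g1 by eventually_elim simp
    then show ?thesis by simp
  next
    case 3
    have "filterlim (\<lambda>c::real. c powr (1 - s)) at_top (at_right 0)" using 3 by real_asymp
    then have "filterlim (\<lambda>c. ((1 - c) powr (- s) - 1) / c * c powr (1 - s)) at_top (at_right 0)"
      using s by (intro filterlim_tendsto_pos_mult_at_top[OF D])
    then have "filterlim g at_top (at_right 0)"
      using filterlim_cong[OF refl refl g_eq] by blast
    then have "eventually (\<lambda>c. B < g c) (at_right 0)" by (simp add: filterlim_at_top_dense)
    then have "eventually (\<lambda>c. False) (at_right (0::real))"
      using g2 by eventually_elim simp
    then show ?thesis by simp
  qed
qed

text \<open>The integral of \<open>fock_ratio m c\<close> is squeezed between two affine functions
  of \<open>c powr s\<close> with the same constant term, so that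
  \<open>powr_two_sided_bound_imp_1\<close> applies to its explicit value.\<close>

lemma berezin_commute_at_0_imp_eq_2:
  fixes m :: real
  assumes m: "m > 0"
    and comm: "\<And>\<alpha> \<delta>. \<alpha> > 0 \<Longrightarrow> \<delta> > 0 \<Longrightarrow>
      berezin \<alpha> m (berezin 1 m (\<lambda>w. of_real (exp (- \<delta> * cmod w powr m)))) 0 =
      berezin 1 m (berezin \<alpha> m (\<lambda>w. of_real (exp (- \<delta> * cmod w powr m)))) 0"
  shows "m = 2"
proof -
  define s where "s = 2 / m"
  define \<kappa> where "\<kappa> = m / (2 * pi * Gamma s)"
  have s: "s > 0" using m by (simp add: s_def)
  have \<kappa>: "\<kappa> > 0" unfolding \<kappa>_def using m s by (intro divide_pos_pos mult_pos_pos Gamma_real_pos) auto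
  note [measurable] = borel_measurable_fock_ratio[OF m] borel_measurable_fock_series[OF m]
  have int: "integrable lborel (fock_ratio m c)" if "0 < c" "c < 1" for c
    using integral_fock_ratio(1)[OF m that comm] .
  have val: "\<kappa> * (LINT w|lborel. fock_ratio m c w) = (1 - c) powr (- s)" if "0 < c" "c < 1" for c
    using integral_fock_ratio(2)[OF m that comm] m less_imp_neq[OF Gamma_real_pos[OF s]]
    by (simp add: \<kappa>_def s_def)
  define q where "q w = fock_series m ((cmod w)\<^sup>2)" for w
  have q: "q w \<ge> 1" for w unfolding q_def by (rule fock_series_ge_1[OF m]) simp
  have [measurable]: "q \<in> borel_measurable borel" unfolding q_def[abs_def] by measurable
  define b where "b = fock_coeff m 1"
  have b: "b > 0" unfolding b_def by (rule fock_coeff_pos[OF m])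
  have pt_lower: "1 / q w + c powr s * (b * (cmod w)\<^sup>2 / q w) \<le> fock_ratio m c w" for c w
  proof -
    have "1 + b * (c powr s * (cmod w)\<^sup>2) \<le> fock_series m (c powr s * (cmod w)\<^sup>2)"
      unfolding b_def by (rule fock_series_ge_linear[OF m]) simp
    then have "(1 + b * (c powr s * (cmod w)\<^sup>2)) / q w \<le> fock_series m (c powr s * (cmod w)\<^sup>2) / q w"
      using q[of w] by (intro divide_right_mono) auto
    then show ?thesis by (simp add: fock_ratio_def q_def s_def add_divide_distrib mult_ac)
  qed
  \<comment> \<open>The ratio at \<open>1/2\<close> serves as a fixed integrable reference; any
    smaller \<open>c\<close> arises from it by the contraction factor
    \<open>(2 * c) powr s \<le> 1\<close>.\<close>
  have pt_upper: "fock_ratio m c w \<le> 1 / q w + (2 * c) powr s * (fock_ratio m (1/2) w - 1 / q w)"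
    if c: "0 < c" "c \<le> 1/2" for c w
  proof -
    have cs: "c powr s = (2 * c) powr s * (1/2) powr s"
      using c by (simp flip: powr_mult)
    have "(2 * c) powr s \<le> 1" using c s by (intro powr_le1) auto
    then have "fock_series m ((2 * c) powr s * ((1/2) powr s * (cmod w)\<^sup>2)) - 1
      \<le> (2 * c) powr s * (fock_series m ((1/2) powr s * (cmod w)\<^sup>2) - 1)"
      by (intro fock_series_contract[OF m]) auto
    then have "(fock_series m (c powr s * (cmod w)\<^sup>2) - 1) / q w
      \<le> ((2 * c) powr s * (fock_series m ((1/2) powr s * (cmod w)\<^sup>2) - 1)) / q w"
      unfolding cs mult.assoc using q[of w] by (intro divide_right_mono) auto
    then show ?thesis
      by (simp add: fock_ratio_def q_def s_def diff_divide_distrib right_diff_distrib)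
  qed
  have half: "integrable lborel (fock_ratio m (1/2))" by (rule int) auto
  have nonneg: "0 \<le> 1 / q w" "0 \<le> b * (cmod w)\<^sup>2 / q w" for w
    using q[of w] b by auto
  \<comment> \<open>Both terms of the lower bound are nonnegative, so each is dominated, up to a
    constant, by the integrable ratio at \<open>1/2\<close>.\<close>
  have int0: "integrable lborel (\<lambda>w. 1 / q w)"
  proof (rule Bochner_Integration.integrable_bound[OF half])
    show "AE w in lborel. norm (1 / q w) \<le> norm (fock_ratio m (1/2) w)"
    proof (rule AE_I2)
      fix w
      have "0 \<le> (1/2) powr s * (b * (cmod w)\<^sup>2 / q w)" using nonneg(2)[of w] by (intro mult_nonneg_nonneg) auto
      then show "norm (1 / q w) \<le> norm (fock_ratio m (1/2) w)"
        using pt_lower[of w "1/2"] nonneg(1)[of w] by simp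
    qed
  qed measurable
  have int1: "integrable lborel (\<lambda>w. b * (cmod w)\<^sup>2 / q w)"
  proof (rule Bochner_Integration.integrable_bound)
    show "integrable lborel (\<lambda>w. 2 powr s * fock_ratio m (1/2) w)" using half by simp
    show "AE w in lborel. norm (b * (cmod w)\<^sup>2 / q w) \<le> norm (2 powr s * fock_ratio m (1/2) w)"
    proof (rule AE_I2)
      fix w
      have two: "2 powr s * (1/2) powr s = (1::real)" by (simp flip: powr_mult)
      have "2 powr s * ((1/2) powr s * (b * (cmod w)\<^sup>2 / q w)) \<le> 2 powr s * fock_ratio m (1/2) w"
        using pt_lower[of w "1/2"] nonneg(1)[of w] by (intro mult_left_mono) (linarith, simp)
      then have "b * (cmod w)\<^sup>2 / q w \<le> 2 powr s * fock_ratio m (1/2) w"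
        unfolding mult.assoc[symmetric] two by simp
      then show "norm (b * (cmod w)\<^sup>2 / q w) \<le> norm (2 powr s * fock_ratio m (1/2) w)"
        unfolding real_norm_def using nonneg(2)[of w] by linarith
    qed
  qed measurable
  define a0 where "a0 = \<kappa> * (LINT w|lborel. 1 / q w)"
  define a1 where "a1 = \<kappa> * (LINT w|lborel. b * (cmod w)\<^sup>2 / q w)"
  define B where "B = 2 powr s * (\<kappa> * (LINT w|lborel. fock_ratio m (1/2) w) - a0)"
  have "a1 > 0"
  proof -
    \<comment> \<open>The integrand vanishes only at the origin; a zero integral would make the
      whole plane a null set.\<close>
    have "(LINT w|lborel. b * (cmod w)\<^sup>2 / q w) \<noteq> 0"
    proof
      assume "(LINT w|lborel. b * (cmod w)\<^sup>2 / q w) = 0"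
      then have "AE w in lborel. b * (cmod w)\<^sup>2 / q w = 0"
        using integral_nonneg_eq_0_iff_AE[OF int1] nonneg by simp
      moreover have "AE w in lborel. w \<noteq> (0::complex)" by (rule AE_lborel_singleton)
      ultimately have "AE w in lborel. (w::complex) \<in> UNIV \<longleftrightarrow> w \<in> {}"
      proof eventually_elim
        case (elim w)
        then show ?case using q[of w] b by auto
      qed
      then have "emeasure lborel (UNIV :: complex set) = emeasure lborel ({} :: complex set)"
        by (intro emeasure_eq_AE) auto
      then show False by simp
    qed
    moreover have "(LINT w|lborel. b * (cmod w)\<^sup>2 / q w) \<ge> 0"
      using nonneg(2) by (intro integral_nonneg_AE) auto
    ultimately show ?thesis unfolding a1_def using \<kappa> by simp
  qed
  moreover have "a0 + a1 * c powr s \<le> (1 - c) powr (- s)" if c: "0 < c" "c \<le> 1/2" for c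
  proof -
    have "(LINT w|lborel. 1 / q w + c powr s * (b * (cmod w)\<^sup>2 / q w)) \<le> (LINT w|lborel. fock_ratio m c w)"
      using c by (intro integral_mono Bochner_Integration.integrable_add int0 integrable_mult_right int1 int pt_lower) auto
    also have "(LINT w|lborel. 1 / q w + c powr s * (b * (cmod w)\<^sup>2 / q w))
        = (LINT w|lborel. 1 / q w) + c powr s * (LINT w|lborel. b * (cmod w)\<^sup>2 / q w)"
      by (subst Bochner_Integration.integral_add[OF int0 integrable_mult_right[OF int1]])
         (simp only: integral_mult_right_zero)
    finally have "\<kappa> * ((LINT w|lborel. 1 / q w) + c powr s * (LINT w|lborel. b * (cmod w)\<^sup>2 / q w))
        \<le> \<kappa> * (LINT w|lborel. fock_ratio m c w)"
      using \<kappa> by simp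
    also have "\<dots> = (1 - c) powr (- s)" using c by (intro val) auto
    finally show ?thesis by (simp add: a0_def a1_def algebra_simps)
  qed
  moreover have "(1 - c) powr (- s) \<le> a0 + B * c powr s" if c: "0 < c" "c \<le> 1/2" for c
  proof -
    have "(LINT w|lborel. fock_ratio m c w)
        \<le> (LINT w|lborel. 1 / q w + (2 * c) powr s * (fock_ratio m (1/2) w - 1 / q w))"
      using c by (intro integral_mono Bochner_Integration.integrable_add Bochner_Integration.integrable_diff
          int0 integrable_mult_right half int pt_upper) auto
    also have "\<dots> = (LINT w|lborel. 1 / q w) + (2 * c) powr s *
        ((LINT w|lborel. fock_ratio m (1/2) w) - (LINT w|lborel. 1 / q w))"
      by (subst Bochner_Integration.integral_add[OF int0 integrable_mult_right[OF
              Bochner_Integration.integrable_diff[OF half int0]]])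
         (simp only: integral_mult_right_zero Bochner_Integration.integral_diff[OF half int0])
    finally have "\<kappa> * (LINT w|lborel. fock_ratio m c w) \<le> \<kappa> * ((LINT w|lborel. 1 / q w) + (2 * c) powr s *
        ((LINT w|lborel. fock_ratio m (1/2) w) - (LINT w|lborel. 1 / q w)))"
      using \<kappa> by simp
    moreover have "\<kappa> * (LINT w|lborel. fock_ratio m c w) = (1 - c) powr (- s)"
      using c by (intro val) auto
    ultimately show ?thesis
      using c by (simp add: a0_def B_def algebra_simps powr_mult)
  qed
  ultimately have "s = 1" by (rule powr_two_sided_bound_imp_1[OF s])
  then show ?thesis using m by (simp add: s_def)
qed

section \<open>The Gaussian case\<close>

lemma distr_lborel_reflect:
  fixes t :: "'a :: euclidean_space"
  shows "distr lborel borel (\<lambda>x. t - x) = lborel"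
  using lborel_affine[of "-1" t] by (simp add: density_1)

lemma
  fixes f :: "'a :: euclidean_space \<Rightarrow> 'b :: {banach, second_countable_topology}"
  assumes [measurable]: "f \<in> borel_measurable borel"
  shows integrable_lborel_reflect: "integrable lborel (\<lambda>x. f (t - x)) \<longleftrightarrow> integrable lborel f"
    and integral_lborel_reflect: "(LINT x|lborel. f (t - x)) = (LINT x|lborel. f x)"
proof -
  have "integrable (distr lborel borel (\<lambda>x. t - x)) f \<longleftrightarrow> integrable lborel (\<lambda>x. f (t - x))"
    by (rule integrable_distr_eq) measurable
  then show "integrable lborel (\<lambda>x. f (t - x)) \<longleftrightarrow> integrable lborel f"
    by (simp add: distr_lborel_reflect)
  have "integral\<^sup>L (distr lborel borel (\<lambda>x. t - x)) f = (LINT x|lborel. f (t - x))"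
    by (rule integral_distr) measurable
  then show "(LINT x|lborel. f (t - x)) = (LINT x|lborel. f x)"
    by (simp add: distr_lborel_reflect)
qed

lemma fock_series_2: "fock_series 2 (x :: 'a :: {real_normed_field, banach}) = exp x"
proof -
  have "fock_coeff 2 n = 1 / fact n" for n
    using Gamma_fact[of n, where 'a = real] by (simp add: fock_coeff_def add_divide_distrib add.commute)
  then show ?thesis
    by (simp add: fock_series_def exp_def scaleR_conv_of_real inverse_eq_divide)
qed

lemma fock_density_2: "fock_density \<alpha> 2 z = \<alpha> / pi * exp (- \<alpha> * (cmod z)\<^sup>2)" if "\<alpha> > 0"
  using that by (simp add: fock_density_def powr_numeral)

lemma fock_density_minus: "fock_density \<alpha> m (x - y) = fock_density \<alpha> m (y - x)"
  by (simp add: fock_density_def norm_minus_commute)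

text \<open>The total mass is that of \<open>fock_borel \<alpha> 2\<close>; since the density is
  even, the translate can be written as a reflection, which preserves \<open>lborel\<close>.\<close>

lemma
  assumes \<alpha>: "\<alpha> > 0"
  shows integrable_gauss: "integrable lborel (\<lambda>w. fock_density \<alpha> 2 (w - z))"
    and integral_gauss: "(LINT w|lborel. fock_density \<alpha> 2 (w - z)) = 1"
proof -
  interpret finite_measure "fock_borel \<alpha> 2" by (rule finite_measure_fock_borel[OF _ \<alpha>]) simp
  have "integrable (fock_borel \<alpha> 2) (\<lambda>_. 1 :: real)" by simp
  then have "integrable lborel (fock_density \<alpha> 2)"
    using integrable_fock_borel[of 2 \<alpha> "\<lambda>_. 1 :: real"] \<alpha> by simp
  then show "integrable lborel (\<lambda>w. fock_density \<alpha> 2 (w - z))"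
    unfolding fock_density_minus[of \<alpha> 2 _ z] by (subst integrable_lborel_reflect) auto
  have "(LINT w|lborel. fock_density \<alpha> 2 w) = 1"
    using integral_fock_borel[of 2 \<alpha> "\<lambda>_. 1 :: real"] integral_fock_borel_const[OF _ \<alpha>, of 2] \<alpha> by simp
  then show "(LINT w|lborel. fock_density \<alpha> 2 (w - z)) = 1"
    unfolding fock_density_minus[of \<alpha> 2 _ z] by (subst integral_lborel_reflect) auto
qed

text \<open>Convolution with a Gaussian: the heat semigroup of the plane at time
  \<open>1 / (4 * \<alpha>)\<close>. Integration is over \<open>lborel\<close>, which suits Fubini
  and substitution for Borel functions.\<close>

definition heat :: "real \<Rightarrow> (complex \<Rightarrow> complex) \<Rightarrow> complex \<Rightarrow> complex" where
  "heat \<alpha> f z = (LINT w|lborel. fock_density \<alpha> 2 (w - z) *\<^sub>R f w)"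

text \<open>For \<open>m = 2\<close> the series is \<open>exp\<close>, and completing the square
  merges density and kernel into one Gaussian centred at \<open>z\<close>.\<close>

lemma berezin_2_lebesgue:
  assumes \<alpha>: "\<alpha> > 0" and f: "f \<in> borel_measurable lebesgue"
  shows "berezin \<alpha> 2 f z = (LINT w|lebesgue. fock_density \<alpha> 2 (w - z) *\<^sub>R f w)"
proof -
  have two: "(0::real) < 2" by simp
  let ?k = "\<lambda>w. (cmod (fock_series 2 (of_real (\<alpha> powr (2 / 2)) * w * cnj z)))\<^sup>2
      / fock_series 2 (\<alpha> powr (2 / 2) * (cmod z)\<^sup>2)"
  have k: "fock_density \<alpha> 2 w * ?k w = fock_density \<alpha> 2 (w - z)" for w
  proof -
    have e: "(cmod (w - z))\<^sup>2 = (cmod w)\<^sup>2 - 2 * Re (w * cnj z) + (cmod z)\<^sup>2"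
      unfolding cmod_power2 by (simp add: power2_eq_square algebra_simps)
    have "?k w = exp (2 * \<alpha> * Re (w * cnj z) - \<alpha> * (cmod z)\<^sup>2)"
      using \<alpha> by (simp add: fock_series_2 norm_exp_eq_Re exp_diff mult.assoc flip: exp_of_nat_mult)
    then show ?thesis
      using \<alpha> by (simp add: fock_density_2 e exp_add[symmetric]) (simp add: algebra_simps)
  qed
  have [measurable]: "?k \<in> borel_measurable borel"
    unfolding fock_series_2 by (intro borel_measurable_continuous_onI continuous_intros) auto
  have meas: "(\<lambda>w. f w * of_real (?k w)) \<in> borel_measurable lebesgue"
  proof (rule borel_measurable_times[OF f])
    have "(\<lambda>w. complex_of_real (?k w)) \<in> borel_measurable borel" by measurable
    then show "(\<lambda>w. complex_of_real (?k w)) \<in> borel_measurable lebesgue"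
      by (simp add: measurable_completion)
  qed
  have "berezin \<alpha> 2 f z = (LINT w|lebesgue. fock_density \<alpha> 2 w *\<^sub>R (f w * of_real (?k w)))"
    unfolding berezin_eq[OF two \<alpha>] by (rule integral_fock_measure[OF two \<alpha> meas])
  also have "\<dots> = (LINT w|lebesgue. fock_density \<alpha> 2 (w - z) *\<^sub>R f w)"
    unfolding k[symmetric] by (simp add: scaleR_conv_of_real mult_ac)
  finally show ?thesis .
qed

lemma berezin_2_borel:
  assumes \<alpha>: "\<alpha> > 0" and f [measurable]: "f \<in> borel_measurable borel"
  shows "berezin \<alpha> 2 f = heat \<alpha> f"
proof
  fix z
  have f': "f \<in> borel_measurable lebesgue" using f by (simp add: measurable_completion)
  show "berezin \<alpha> 2 f z = heat \<alpha> f z"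
    unfolding heat_def berezin_2_lebesgue[OF \<alpha> f']
    by (subst integral_completion) measurable
qed

text \<open>Real and imaginary parts are replaced separately by Borel functions; this prepares for
  Fubini's theorem, where a Borel function with a bound at every point is convenient.\<close>

lemma Linfty_borel_representative:
  assumes "f \<in> Linfty"
  obtains g C where "g \<in> borel_measurable borel" "\<And>z. cmod (g z) \<le> C" "AE z in lebesgue. f z = g z"
proof -
  from assms obtain C where f: "f \<in> borel_measurable lebesgue" and C: "AE z in lebesgue. cmod (f z) \<le> C"
    by (auto simp: Linfty_def)
  have "(\<lambda>z. Re (f z)) \<in> borel_measurable lebesgue" "(\<lambda>z. Im (f z)) \<in> borel_measurable lebesgue"
    using f by (auto intro: measurable_compose)
  then obtain g1 g2 where g [measurable]: "g1 \<in> borel_measurable lborel" "g2 \<in> borel_measurable lborel"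
    and ae: "AE z in lborel. Re (f z) = g1 z" "AE z in lborel. Im (f z) = g2 z"
    by (metis completion_ex_borel_measurable_real)
  define h where "h z = of_real (g1 z) + \<i> * of_real (g2 z)" for z
  have [measurable]: "h \<in> borel_measurable borel"
    unfolding h_def[abs_def] using g by (simp) measurable
  \<comment> \<open>Cutting off turns the almost everywhere bound into one at every point; the
    absolute value makes the bound valid also where \<open>k\<close> is 0.\<close>
  define k where "k z = (if cmod (h z) \<le> \<bar>C\<bar> then h z else 0)" for z
  have "k \<in> borel_measurable borel" unfolding k_def[abs_def] by measurable
  moreover have "cmod (k z) \<le> \<bar>C\<bar>" for z by (simp add: k_def)
  moreover have "AE z in lebesgue. f z = k z"
    using AE_completion[OF ae(1)] AE_completion[OF ae(2)] C
  proof eventually_elim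
    case (elim z)
    have "f z = h z" using elim by (simp add: h_def complex_eq_iff)
    then show ?case using elim by (simp add: k_def)
  qed
  ultimately show ?thesis by (rule that)
qed

text \<open>The first transform of a Lebesgue measurable function depends only on its Borel
  representative. The result is Borel, so \<open>berezin_2_borel\<close> handles the second
  transform.\<close>

lemma berezin_2_Linfty:
  assumes \<alpha>: "\<alpha> > 0" and f: "f \<in> Linfty"
    and g [measurable]: "g \<in> borel_measurable borel" and fg: "AE z in lebesgue. f z = g z"
  shows "berezin \<alpha> 2 f = heat \<alpha> g"
proof
  fix z
  have f': "f \<in> borel_measurable lebesgue" and g': "g \<in> borel_measurable lebesgue"
    using f g by (auto simp: Linfty_def measurable_completion)
  have d: "(\<lambda>w. fock_density \<alpha> 2 (w - z)) \<in> borel_measurable lebesgue"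
    by (rule measurable_completion) measurable
  have "berezin \<alpha> 2 f z = berezin \<alpha> 2 g z"
    unfolding berezin_2_lebesgue[OF \<alpha> f'] berezin_2_lebesgue[OF \<alpha> g']
    by (rule integral_cong_AE) (use fg d f' g' in \<open>auto intro: borel_measurable_scaleR\<close>)
  then show "berezin \<alpha> 2 f z = heat \<alpha> g z"
    by (simp add: berezin_2_borel[OF \<alpha> g])
qed

lemma borel_measurable_heat [measurable]:
  assumes [measurable]: "f \<in> borel_measurable borel"
  shows "heat \<alpha> f \<in> borel_measurable borel"
  unfolding heat_def[abs_def] by measurable

text \<open>Fubini brings the integral over the intermediate point \<open>v\<close> inside, leaving
  a convolution of two Gaussians there. Integrability holds since \<open>C\<close> times the product
  of the Gaussians dominates, and the \<open>w\<close>-integral of that bound is \<open>C\<close>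
  times a Gaussian in \<open>v\<close>.\<close>

lemma heat_heat:
  assumes \<alpha>: "\<alpha> > 0" and \<beta>: "\<beta> > 0"
    and f [measurable]: "f \<in> borel_measurable borel" and C: "\<And>z. cmod (f z) \<le> C"
  shows "heat \<beta> (heat \<alpha> f) z = (LINT w|lborel. LINT v|lborel.
    (fock_density \<beta> 2 (v - z) * fock_density \<alpha> 2 (w - v)) *\<^sub>R f w)"
proof -
  let ?h = "\<lambda>v w. (fock_density \<beta> 2 (v - z) * fock_density \<alpha> 2 (w - v)) *\<^sub>R f w"
  have nn: "fock_density \<alpha> 2 x \<ge> 0" "fock_density \<beta> 2 x \<ge> 0" for x
    using \<alpha> \<beta> by (auto intro: fock_density_nonneg)
  have C0: "C \<ge> 0" using C[of 0] norm_ge_zero order_trans by blast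
  have bd: "norm (?h v w) \<le> fock_density \<beta> 2 (v - z) * C * fock_density \<alpha> 2 (w - v)" for v w
  proof -
    have "norm (?h v w) = fock_density \<beta> 2 (v - z) * fock_density \<alpha> 2 (w - v) * cmod (f w)"
      using nn by (simp add: abs_mult)
    also have "\<dots> \<le> fock_density \<beta> 2 (v - z) * fock_density \<alpha> 2 (w - v) * C"
      using nn C by (intro mult_left_mono mult_nonneg_nonneg) auto
    finally show ?thesis by (simp add: mult_ac)
  qed
  have dom: "integrable lborel (\<lambda>w. fock_density \<beta> 2 (v - z) * C * fock_density \<alpha> 2 (w - v))" for v
    by (intro integrable_mult_right integrable_gauss \<alpha>)
  have int: "integrable lborel (?h v)" for v
  proof (rule Bochner_Integration.integrable_bound[OF dom])
    show "AE w in lborel. norm (?h v w) \<le> norm (fock_density \<beta> 2 (v - z) * C * fock_density \<alpha> 2 (w - v))"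
      by (intro AE_I2 order_trans[OF bd]) (simp only: real_norm_def abs_ge_self)
  qed measurable
  have prod: "integrable (lborel \<Otimes>\<^sub>M lborel) (\<lambda>(v, w). ?h v w)"
  proof (rule lborel_pair.Fubini_integrable)
    show "(\<lambda>(v, w). ?h v w) \<in> borel_measurable (lborel \<Otimes>\<^sub>M lborel)" by measurable
    show "AE v in lborel. integrable lborel (\<lambda>w. case (v, w) of (v, w) \<Rightarrow> ?h v w)"
      using int by simp
    show "integrable lborel (\<lambda>v. LINT w|lborel. norm (case (v, w) of (v, w) \<Rightarrow> ?h v w))"
    proof (rule Bochner_Integration.integrable_bound)
      show "integrable lborel (\<lambda>v. C * fock_density \<beta> 2 (v - z))"
        by (intro integrable_mult_right integrable_gauss \<beta>)
      show "AE v in lborel. norm (LINT w|lborel. norm (case (v, w) of (v, w) \<Rightarrow> ?h v w)) \<le> norm (C * fock_density \<beta> 2 (v - z))"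
      proof (rule AE_I2)
        fix v
        have "(LINT w|lborel. norm (?h v w)) \<le> (LINT w|lborel. fock_density \<beta> 2 (v - z) * C * fock_density \<alpha> 2 (w - v))"
          by (rule integral_mono[OF integrable_norm[OF int] dom bd])
        also have "\<dots> = C * fock_density \<beta> 2 (v - z)"
          by (simp add: integral_gauss[OF \<alpha>])
        finally have "(LINT w|lborel. norm (?h v w)) \<le> C * fock_density \<beta> 2 (v - z)" .
        moreover have "(LINT w|lborel. norm (?h v w)) \<ge> 0"
          by (rule integral_nonneg_AE) (simp add: AE_I2)
        ultimately show "norm (LINT w|lborel. norm (case (v, w) of (v, w) \<Rightarrow> ?h v w)) \<le> norm (C * fock_density \<beta> 2 (v - z))"
          unfolding real_norm_def prod.case by linarith
      qed
    qed measurable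
  qed
  have "heat \<beta> (heat \<alpha> f) z = (LINT v|lborel. LINT w|lborel. ?h v w)"
    unfolding heat_def by (simp flip: integral_scaleR_right)
  also have "\<dots> = (LINT w|lborel. LINT v|lborel. ?h v w)"
    using lborel_pair.Fubini_integral[OF prod] by simp
  finally show ?thesis .
qed

text \<open>The substitution \<open>v \<mapsto> w + z - v\<close> in the inner integral exchanges the two Gaussians.\<close>
lemma heat_commute:
  assumes \<alpha>: "\<alpha> > 0" and \<beta>: "\<beta> > 0"
    and f [measurable]: "f \<in> borel_measurable borel" and C: "\<And>z. cmod (f z) \<le> C"
  shows "heat \<beta> (heat \<alpha> f) = heat \<alpha> (heat \<beta> f)"
proof
  fix z
  have "(LINT v|lborel. (fock_density \<beta> 2 (v - z) * fock_density \<alpha> 2 (w - v)) *\<^sub>R f w)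
      = (LINT v|lborel. (fock_density \<alpha> 2 (v - z) * fock_density \<beta> 2 (w - v)) *\<^sub>R f w)" for w
  proof -
    have "(LINT v|lborel. (fock_density \<beta> 2 (v - z) * fock_density \<alpha> 2 (w - v)) *\<^sub>R f w)
      = (LINT v|lborel. (fock_density \<beta> 2 ((w + z - v) - z) * fock_density \<alpha> 2 (w - (w + z - v))) *\<^sub>R f w)"
      by (rule integral_lborel_reflect[symmetric]) measurable
    then show ?thesis by (simp add: fock_density_minus[of \<alpha> 2 v z for v] mult.commute)
  qed
  then show "heat \<beta> (heat \<alpha> f) z = heat \<alpha> (heat \<beta> f) z"
    unfolding heat_heat[OF \<alpha> \<beta> f C] heat_heat[OF \<beta> \<alpha> f C] by simp
qed

lemma berezin_2_commute:
  assumes "\<alpha> > 0" "\<beta> > 0" "f \<in> Linfty"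
  shows "berezin \<alpha> 2 (berezin \<beta> 2 f) = berezin \<beta> 2 (berezin \<alpha> 2 f)"
proof -
  obtain g C where g: "g \<in> borel_measurable borel" and C: "\<And>z. cmod (g z) \<le> C"
    and fg: "AE z in lebesgue. f z = g z"
    using Linfty_borel_representative[OF assms(3)] by blast
  have "berezin \<alpha> 2 (berezin \<beta> 2 f) = heat \<alpha> (heat \<beta> g)"
    using assms g fg by (simp add: berezin_2_Linfty berezin_2_borel borel_measurable_heat)
  also have "\<dots> = heat \<beta> (heat \<alpha> g)"
    by (rule heat_commute[OF assms(2,1) g C])
  also have "\<dots> = berezin \<beta> 2 (berezin \<alpha> 2 f)"
    using assms g fg by (simp add: berezin_2_Linfty berezin_2_borel borel_measurable_heat)
  finally show ?thesis .
qed

theorem theoremA: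
  fixes m :: real
  assumes "m > 0"
  defines "fd \<equiv> (\<lambda>\<delta>::real. \<lambda>z::complex. complex_of_real (exp (- \<delta> * cmod z powr m)))"
  shows "((\<forall>f\<in>Linfty. \<forall>\<alpha>>0. \<forall>\<beta>>0.
             berezin \<alpha> m (berezin \<beta> m f) = berezin \<beta> m (berezin \<alpha> m f))
          \<longleftrightarrow> (\<forall>\<alpha>>0. \<forall>\<beta>>0. \<forall>\<delta>>0.
             berezin \<alpha> m (berezin \<beta> m (fd \<delta>)) = berezin \<beta> m (berezin \<alpha> m (fd \<delta>))))
       \<and> ((\<forall>\<alpha>>0. \<forall>\<beta>>0. \<forall>\<delta>>0.
             berezin \<alpha> m (berezin \<beta> m (fd \<delta>)) = berezin \<beta> m (berezin \<alpha> m (fd \<delta>)))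
          \<longleftrightarrow> (\<forall>\<alpha>>0. \<forall>\<beta>>0. \<forall>\<delta>>0.
             berezin \<alpha> m (berezin \<beta> m (fd \<delta>)) 0 = berezin \<beta> m (berezin \<alpha> m (fd \<delta>)) 0))
       \<and> ((\<forall>\<alpha>>0. \<forall>\<beta>>0. \<forall>\<delta>>0.
             berezin \<alpha> m (berezin \<beta> m (fd \<delta>)) 0 = berezin \<beta> m (berezin \<alpha> m (fd \<delta>)) 0)
          \<longleftrightarrow> m = 2)"
    (is "(?P1 \<longleftrightarrow> ?P2) \<and> (?P2 \<longleftrightarrow> ?P3) \<and> (?P3 \<longleftrightarrow> m = 2)")
proof -
  have fd_Linfty: "fd \<delta> \<in> Linfty" if "\<delta> > 0" for \<delta>
  proof -
    have "fd \<delta> \<in> borel_measurable borel" unfolding fd_def by measurable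
    moreover have "cmod (fd \<delta> z) \<le> 1" for z using that by (simp add: fd_def)
    ultimately show ?thesis unfolding Linfty_def by (auto simp: measurable_completion)
  qed
  have "?P1 \<Longrightarrow> ?P2" using fd_Linfty by blast
  moreover have "?P2 \<Longrightarrow> ?P3" by simp
  moreover have "?P3 \<Longrightarrow> m = 2"
    unfolding fd_def by (rule berezin_commute_at_0_imp_eq_2[OF assms(1)]) simp
  moreover have "m = 2 \<Longrightarrow> ?P1" using berezin_2_commute by blast
  ultimately show ?thesis by blast
qed

end
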